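(* There exist a Borel probability measure $\mu$ on $\mathbb{R}$ and a square function operator $S$ on $\mathbb{R}$ (given by a family of kernels $(s_t)_{t>0}$) with the following properties. (i) The measure $\mu$ and the kernels $s_t$ satisfy, for some $0<m<1$ and some $\alpha>0$: $\mu(B(x,r))\lesssim r^m$ for all $x\in\mathbb{R}$, $r>0$; $|s_t(x,y)|\lesssim\frac{t^\alpha}{(t+|x-y|)^{m+\alpha}}$ for all $x,y\in\mathbb{R}$, $t>0$; and $|s_t(x,y)-s_t(x,z)|\lesssim\frac{|y-z|^\alpha}{(t+|x-y|)^{m+\alpha}}$ whenever $|y-z|<t/2$. (ii) The operator $S$ is bounded on $L^2(\mu)$, but $S_\beta(1)\notin L^2(\mu)$ for any $\beta>1$.
   Context: For kernels $s_t$, $t>0$, set $\theta_tf(x)=\int_{\mathbb{R}}s_t(x,y)f(y)\,d\mu(y)$. For $\beta>0$ let $\Gamma_\beta(x)=\{(y,t)\in\mathbb{R}\times(0,\infty):|y-x|<\beta t\}$ and $$S_\beta f(x)=\left(\iint_{\Gamma_\beta(x)}|\theta_tf(y)|^2\,\frac{d\mu(y)\,dt}{t^{m+1}}\right)^{1/2}.$$ The conical square function is $S=S_1$. Here $1$ denotes the constant function, and $A\lesssim B$ means $A\le CB$ with a finite constant $C$ independent of $x,y,z,t,r$. *)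

theory Defs
  imports "HOL-Analysis.Analysis" "HOL-Probability.Probability_Measure"
begin

text \<open>
  Conical square functions on \<open>\<real>\<close> with respect to a Borel measure \<open>\<mu>\<close>. Square functions take values
  in \<open>[0,\<infinity>]\<close>, hence in \<^typ>\<open>ennreal\<close>, for which the library has no square root.
\<close>

definition esqrt :: "ennreal \<Rightarrow> ennreal" where
  "esqrt a = (if a = \<infinity> then \<infinity> else ennreal (sqrt (enn2real a)))"

definition L2_norm :: "'a measure \<Rightarrow> ('a \<Rightarrow> ennreal) \<Rightarrow> ennreal" where
  "L2_norm M g = esqrt (\<integral>\<^sup>+ x. (g x)\<^sup>2 \<partial>M)"

definition mem_L2 :: "'a measure \<Rightarrow> ('a \<Rightarrow> ennreal) \<Rightarrow> bool" where
  "mem_L2 M g \<longleftrightarrow> g \<in> borel_measurable M \<and> L2_norm M g < \<infinity>"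

definition cmem_L2 :: "'a measure \<Rightarrow> ('a \<Rightarrow> complex) \<Rightarrow> bool" where
  "cmem_L2 M f \<longleftrightarrow> f \<in> borel_measurable M \<and> L2_norm M (\<lambda>x. ennreal (cmod (f x))) < \<infinity>"

text \<open>Boundedness of a (not necessarily linear) operator from \<open>L\<^sup>2\<close> to \<open>[0,\<infinity>]\<close>-valued functions.\<close>

definition bounded_on_L2 :: "'a measure \<Rightarrow> (('a \<Rightarrow> complex) \<Rightarrow> 'a \<Rightarrow> ennreal) \<Rightarrow> bool" where
  "bounded_on_L2 M T \<longleftrightarrow>
     (\<exists>C::real. \<forall>f. cmem_L2 M f \<longrightarrow>
        mem_L2 M (T f) \<and> L2_norm M (T f) \<le> ennreal C * L2_norm M (\<lambda>x. ennreal (cmod (f x))))"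

text \<open>
  A kernel family is \<open>s t x y\<close> with \<open>t > 0\<close>; values at \<open>t \<le> 0\<close> are irrelevant throughout. Joint
  Borel measurability is what makes \<open>\<theta>\<close> and the square functions meaningful as integrals.
\<close>

definition measurable_kernels :: "(real \<Rightarrow> real \<Rightarrow> real \<Rightarrow> complex) \<Rightarrow> bool" where
  "measurable_kernels s \<longleftrightarrow>
     (\<lambda>(t, x, y). s t x y) \<in> borel_measurable (restrict_space borel ({0<..} \<times> UNIV))"

definition theta :: "real measure \<Rightarrow> (real \<Rightarrow> real \<Rightarrow> real \<Rightarrow> complex) \<Rightarrow> real \<Rightarrow>
    (real \<Rightarrow> complex) \<Rightarrow> real \<Rightarrow> complex" where
  "theta \<mu> s t f x = (LINT y|\<mu>. s t x y * f y)"

definition cone :: "real \<Rightarrow> real \<Rightarrow> (real \<times> real) set" where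
  "cone \<beta> x = {(y, t). 0 < t \<and> \<bar>y - x\<bar> < \<beta> * t}"

definition square_fun :: "real measure \<Rightarrow> real \<Rightarrow> (real \<Rightarrow> real \<Rightarrow> real \<Rightarrow> complex) \<Rightarrow> real \<Rightarrow>
    (real \<Rightarrow> complex) \<Rightarrow> real \<Rightarrow> ennreal" where
  "square_fun \<mu> m s \<beta> f x =
     esqrt (\<integral>\<^sup>+ p \<in> cone \<beta> x.
       (case p of (y, t) \<Rightarrow> ennreal ((cmod (theta \<mu> s t f y))\<^sup>2 / t powr (m + 1))) \<partial>(\<mu> \<Otimes>\<^sub>M lborel))"

definition growth_condition :: "real measure \<Rightarrow> real \<Rightarrow> bool" where
  "growth_condition \<mu> m \<longleftrightarrow> (\<exists>C. \<forall>x. \<forall>r>0. measure \<mu> (ball x r) \<le> C * r powr m)"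

definition kernel_size :: "(real \<Rightarrow> real \<Rightarrow> real \<Rightarrow> complex) \<Rightarrow> real \<Rightarrow> real \<Rightarrow> bool" where
  "kernel_size s m \<alpha> \<longleftrightarrow>
     (\<exists>C. \<forall>t>0. \<forall>x y. cmod (s t x y) \<le> C * (t powr \<alpha> / (t + \<bar>x - y\<bar>) powr (m + \<alpha>)))"

definition kernel_smoothness :: "(real \<Rightarrow> real \<Rightarrow> real \<Rightarrow> complex) \<Rightarrow> real \<Rightarrow> real \<Rightarrow> bool" where
  "kernel_smoothness s m \<alpha> \<longleftrightarrow>
     (\<exists>C. \<forall>t>0. \<forall>x y z. \<bar>y - z\<bar> < t / 2 \<longrightarrow>
        cmod (s t x y - s t x z) \<le> C * (\<bar>y - z\<bar> powr \<alpha> / (t + \<bar>x - y\<bar>) powr (m + \<alpha>)))"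

end

theory Submission
  imports Defs
begin

text \<open>
  Write \<open>\<mu>\<close> for the measure. By Tonelli, \<open>\<parallel>S\<^sub>\<beta> f\<parallel>\<^sup>2\<close> is the integral of
  \<open>\<mu>(B(y, \<beta> t)) |\<theta>\<^sub>t f(y)|\<^sup>2 / t\<^bsup>m+1\<^esup>\<close> over \<open>y\<close> and \<open>t\<close>
  (\<open>square_fun_Tonelli\<close>), so the aperture enters only through the mass of \<open>B(y, \<beta> t)\<close>. The kernels
  may be switched on and off freely in \<open>(y, t)\<close>, since no regularity in these variables is asked for.
  The idea is to switch them on only at pairs \<open>(y, t)\<close> for which \<open>B(y, t)\<close> has far less mass than
  \<open>t\<^sup>m\<close>, while \<open>B(y, \<beta> t)\<close> has mass comparable with \<open>t\<^sup>m\<close> for every \<open>\<beta> > 1\<close>, provided that \<open>t\<close> is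
  close enough to the right end of its range.

  The measure is a Cantor measure of dimension \<open>m = 1/2\<close>. A cell of generation \<open>k\<close> has mass \<open>M\<^sub>k\<close> and
  size \<open>L\<^sub>k = M\<^sub>k\<^sup>2\<close>; it consists of \<open>N\<^sub>k = k + 100\<close> children of equal mass. All but one of them are spread
  evenly over a cluster of length about \<open>L\<^sub>k\<close>, and the last one, the stray child, sits at
  distance about \<open>L\<^sub>k\<close> to the right of the cluster. The kernel is a bump of width about \<open>t\<close>, switched on for \<open>y\<close>
  in a stray child and \<open>L\<^sub>k/2 \<le> t \<le> L\<^sub>k\<close>. For such a pair \<open>B(y, t)\<close> meets no other child, so its mass
  is at most of order \<open>M\<^sub>k/N\<^sub>k\<close>, but \<open>B(y, \<beta> t)\<close> reaches a fixed fraction of the cluster as soon as \<open>t\<close> is close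
  to \<open>L\<^sub>k\<close> and \<open>k\<close> is large.

  The stray children of generation \<open>k\<close> form a fraction \<open>1/N\<^sub>k\<close> of the mass. In the energy of \<open>S\<^sub>1\<close> this
  factor occurs twice, once for the small mass of \<open>B(y, t)\<close> and once for the rarity of \<open>y\<close>, so generation
  \<open>k\<close> contributes at most \<open>C/N\<^sub>k\<^sup>2 \<cdot> \<parallel>f\<parallel>\<^sup>2\<close>, which is summable (\<open>bounded_square_fun\<close>). In the energy of
  \<open>S\<^sub>\<beta> 1\<close> only the rarity of \<open>y\<close> remains; generation \<open>k\<close> contributes at least \<open>c\<^sub>\<beta>/N\<^sub>k\<close>, and the harmonic
  series diverges (\<open>square_fun_one_not_L2\<close>).

  The geometry is organised by a map \<open>F\<close> from \<open>[0,1)\<close> to the line, under which \<open>\<mu>\<close> is the image of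
  Lebesgue measure, so that all masses become lengths of intervals. Two points in one cell of
  generation \<open>k\<close> have images at distance at most \<open>3 L\<^sub>k\<close> (\<open>cantor_point_close\<close>), and two points in
  different cells have images at distance at least \<open>97 L\<^sub>k\<close> (\<open>cantor_point_separated\<close>). The growth
  condition holds because the inverse of \<open>F\<close> is Hoelder continuous of order \<open>1/2\<close>
  (\<open>cantor_point_inverse_Hoelder\<close>).
\<close>

section \<open>A Cantor set with stray children\<close>

text \<open>
  The branching numbers have to satisfy \<open>\<Sum> 1/N\<^sub>k = \<infinity>\<close> and \<open>\<Sum> 1/N\<^sub>k\<^sup>2 < \<infinity>\<close>. The shift by \<open>100\<close> makes the
  ratios between consecutive lengths (cell, spacing, child) so large that crude constants suffice.
\<close>
definition branching :: "nat \<Rightarrow> nat" where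
  "branching k = k + 100"

definition cells :: "nat \<Rightarrow> nat" where
  "cells k = (\<Prod>i<k. branching i)"

definition cell_mass :: "nat \<Rightarrow> real" where
  "cell_mass k = 1 / real (cells k)"

text \<open>The square is what makes the dimension equal to \<open>1/2\<close>: the mass of a cell is the root of its size.\<close>
definition cell_size :: "nat \<Rightarrow> real" where
  "cell_size k = (cell_mass k)\<^sup>2"

definition spacing :: "nat \<Rightarrow> real" where
  "spacing k = cell_size k / real (branching k)"

text \<open>
  The cells of generation \<open>k\<close> in the parameter interval are the \<open>P\<^sub>k\<close> intervals of length \<open>1/P\<^sub>k\<close>, where
  \<open>P\<^sub>k\<close> is their number; the digit of \<open>u\<close> says which child of its cell of generation \<open>k\<close> contains \<open>u\<close>.
\<close>
definition cell :: "nat \<Rightarrow> real \<Rightarrow> int" where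
  "cell k u = \<lfloor>u * real (cells k)\<rfloor>"

definition digit :: "nat \<Rightarrow> real \<Rightarrow> int" where
  "digit k u = cell (Suc k) u mod int (branching k)"

text \<open>
  The cluster of children fills a stretch of length about \<open>cell_size k\<close>. The last child is moved to
  \<open>2 * cell_size k\<close>, which leaves a gap slightly longer than \<open>cell_size k\<close> before it.
\<close>
definition offset :: "nat \<Rightarrow> int \<Rightarrow> real" where
  "offset k a = (if a < int (branching k) - 1 then of_int a * spacing k else 2 * cell_size k)"

definition cantor_point :: "real \<Rightarrow> real" where
  "cantor_point u = (\<Sum>k. offset k (digit k u))"

lemma branching_ge: "real (branching k) \<ge> 100"
  by (simp add: branching_def)

lemma cells_pos: "cells k > 0"
  by (simp add: cells_def branching_def prod_pos)

lemma cells_Suc: "cells (Suc k) = cells k * branching k"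
  by (simp add: cells_def)

lemma cell_mass_pos: "cell_mass k > 0"
  using cells_pos[of k] by (simp add: cell_mass_def)

lemma cell_size_pos: "cell_size k > 0"
  using cell_mass_pos[of k] by (simp add: cell_size_def)

lemma spacing_pos: "spacing k > 0"
  using cell_size_pos[of k] branching_ge[of k] by (simp add: spacing_def)

lemma cell_mass_Suc: "cell_mass (Suc k) = cell_mass k / real (branching k)"
  by (simp add: cell_mass_def cells_Suc)

lemma cell_size_eq: "cell_size k = real (branching k) * spacing k"
  using branching_ge[of k] by (simp add: spacing_def)

lemma spacing_eq: "spacing k = real (branching k) * cell_size (Suc k)"
  using branching_ge[of k]
  by (simp add: spacing_def cell_size_def cell_mass_Suc power2_eq_square field_simps)

lemma spacing_eq_mass: "spacing k = cell_mass k * cell_mass (Suc k)"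
  by (simp add: spacing_def cell_size_def cell_mass_Suc power2_eq_square)

lemma spacing_ge: "100 * cell_size (Suc k) \<le> spacing k"
  unfolding spacing_eq using branching_ge[of k] cell_size_pos[of "Suc k"]
  by (intro mult_right_mono) auto

lemma cell_size_ge: "100 * spacing k \<le> cell_size k"
  unfolding cell_size_eq[of k] using branching_ge[of k] spacing_pos[of k]
  by (intro mult_right_mono) auto

lemma cell_size_Suc_le: "10000 * cell_size (Suc k) \<le> cell_size k"
  using spacing_ge[of k] cell_size_ge[of k] by linarith

text \<open>The true ratio is much smaller; \<open>1/4\<close> already gives a tail of at most \<open>3 * cell_size j\<close> below.\<close>
lemma cell_size_geometric: "cell_size (i + k) \<le> cell_size k * (1/4) ^ i"
proof (induction i)
  case (Suc i)
  then show ?case using cell_size_Suc_le[of "i + k"] cell_size_pos[of "i+k"] cell_size_pos[of "Suc (i+k)"]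
    by simp
qed simp

lemma cell_size_antimono: "j \<le> k \<Longrightarrow> cell_size k \<le> cell_size j"
  by (rule lift_Suc_antimono_le) (use cell_size_Suc_le cell_size_pos in \<open>smt (verit)\<close>)

lemma cell_size_LIMSEQ: "cell_size \<longlonglongrightarrow> 0"
proof (rule tendsto_sandwich[of "\<lambda>_. 0" _ _ "\<lambda>i. cell_size 0 * (1/4) ^ i"])
  show "(\<lambda>i. cell_size 0 * (1/4) ^ i) \<longlonglongrightarrow> 0"
    by (intro tendsto_mult_right_zero LIMSEQ_power_zero) simp
qed (use cell_size_geometric[of _ 0] cell_size_pos in \<open>auto intro!: always_eventually less_imp_le\<close>)

lemma cell_div: "cell (Suc k) u div int (branching k) = cell k u"
proof -
  have "\<lfloor>u * real (cells (Suc k)) / real_of_int (int (branching k))\<rfloor>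
      = \<lfloor>u * real (cells (Suc k))\<rfloor> div int (branching k)"
    by (rule floor_divide_real_eq_div) simp
  moreover have "u * real (cells (Suc k)) / real_of_int (int (branching k)) = u * real (cells k)"
    using branching_ge[of k] by (simp add: cells_Suc)
  ultimately show ?thesis by (simp add: cell_def)
qed

lemma cell_Suc: "cell (Suc k) u = cell k u * int (branching k) + digit k u"
  unfolding digit_def cell_div[of k u, symmetric] by simp

lemma digit_bounds: "0 \<le> digit k u" "digit k u \<le> int (branching k) - 1"
  using branching_ge[of k] by (auto simp: digit_def zle_diff1_eq pos_mod_bound pos_mod_sign)

lemma cell_eq_mono: "cell k u = cell k v \<Longrightarrow> j \<le> k \<Longrightarrow> cell j u = cell j v"
proof (induction k)
  case (Suc k)
  then show ?case using cell_div[of k u] cell_div[of k v] by (metis le_Suc_eq)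
qed simp

lemma digit_eq_of_cell: "cell k u = cell k v \<Longrightarrow> j < k \<Longrightarrow> digit j u = digit j v"
  unfolding digit_def using cell_eq_mono[of k u v "Suc j"] by simp

lemma cell_0_iff: "cell 0 u = 0 \<longleftrightarrow> u \<in> {0..<1}"
  by (auto simp: cell_def cells_def floor_eq_iff)

lemma cell_iff: "cell k u = c \<longleftrightarrow> of_int c * cell_mass k \<le> u \<and> u < (of_int c + 1) * cell_mass k"
  using cells_pos[of k] unfolding cell_def floor_eq_iff cell_mass_def
  by (simp add: field_simps)

lemma cell_diff_less: "\<bar>u - v\<bar> < (of_int \<bar>cell k u - cell k v\<bar> + 1) * cell_mass k"
proof -
  have "\<bar>u * real (cells k) - v * real (cells k)\<bar> < of_int \<bar>cell k u - cell k v\<bar> + 1"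
    unfolding cell_def by linarith
  moreover have "\<bar>u * real (cells k) - v * real (cells k)\<bar> = \<bar>u - v\<bar> / cell_mass k"
    by (simp add: cell_mass_def abs_mult flip: left_diff_distrib)
  ultimately show ?thesis using cell_mass_pos[of k] by (simp add: field_simps)
qed

lemma offset_bounds: assumes "0 \<le> a" "a \<le> int (branching k) - 1"
  shows "0 \<le> offset k a" "offset k a \<le> 2 * cell_size k"
proof -
  have "of_int a * spacing k \<le> real (branching k) * spacing k"
    using assms spacing_pos[of k] by (intro mult_right_mono) auto
  then show "0 \<le> offset k a" "offset k a \<le> 2 * cell_size k"
    using assms cell_size_pos[of k] spacing_pos[of k] cell_size_eq[of k] by (auto simp: offset_def)
qed

text \<open>
  Inside the cluster a digit counts for exactly one spacing, and the stray child is farther out, since \<open>2 * cell_size k\<close> is twice \<open>branching k * spacing k\<close>.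
\<close>
lemma offset_gap:
  assumes "0 \<le> a" "a < b" "b \<le> int (branching k) - 1"
  shows "offset k b - offset k a \<ge> of_int (b - a) * spacing k"
proof -
  have "of_int b * spacing k \<le> real (branching k) * spacing k"
    using assms spacing_pos[of k] by (intro mult_right_mono) auto
  then show ?thesis
    using assms cell_size_pos[of k] spacing_pos[of k] cell_size_eq[of k]
    by (auto simp: offset_def algebra_simps)
qed

text \<open>The position of a point relative to the left end of its cell of generation \<open>j\<close>.\<close>
definition tail :: "nat \<Rightarrow> real \<Rightarrow> real" where
  "tail j u = (\<Sum>i. offset (i + j) (digit (i + j) u))"

lemma summable_tail: "summable (\<lambda>i. offset (i + j) (digit (i + j) u))"
  and tail_nonneg: "0 \<le> tail j u"
  and tail_le: "tail j u \<le> 3 * cell_size j"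
proof -
  have le: "offset (i + j) (digit (i + j) u) \<le> 2 * cell_size j * (1/4) ^ i" for i
    using offset_bounds(2)[OF digit_bounds[of "i + j" u]] cell_size_geometric[of i j] by simp
  have nn: "0 \<le> offset (i + j) (digit (i + j) u)" for i
    using offset_bounds(1)[OF digit_bounds[of "i + j" u]] .
  have geo: "(\<lambda>i. 2 * cell_size j * (1/4) ^ i) sums (2 * cell_size j * (1 / (1 - 1/4)))"
    by (intro sums_mult geometric_sums) simp
  show s: "summable (\<lambda>i. offset (i + j) (digit (i + j) u))"
    using le nn by (intro summable_comparison_test'[OF sums_summable[OF geo]]) auto
  show "0 \<le> tail j u" unfolding tail_def using nn s by (intro suminf_nonneg)
  have "tail j u \<le> 2 * cell_size j * (1 / (1 - 1/4))"
    unfolding tail_def using suminf_le[OF le s sums_summable[OF geo]] sums_unique[OF geo] by simp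
  then show "tail j u \<le> 3 * cell_size j" using cell_size_pos[of j] by simp
qed

lemma cantor_point_split: "cantor_point u = (\<Sum>i<j. offset i (digit i u)) + tail j u"
  unfolding cantor_point_def tail_def using summable_tail[of 0 u]
  by (subst suminf_split_initial_segment[of _ j]) simp_all

lemma cantor_point_diff:
  assumes "cell k u = cell k v"
  shows "cantor_point u - cantor_point v = tail k u - tail k v"
  using digit_eq_of_cell[OF assms] by (simp add: cantor_point_split[of _ k])

lemma tail_Suc: "tail k u = offset k (digit k u) + tail (Suc k) u"
  using cantor_point_split[of u k] cantor_point_split[of u "Suc k"] by simp

lemma cantor_point_close:
  assumes "cell k u = cell k v"
  shows "\<bar>cantor_point u - cantor_point v\<bar> \<le> 3 * cell_size k"
  using cantor_point_diff[OF assms] tail_nonneg[of k u] tail_nonneg[of k v] tail_le[of k u] tail_le[of k v]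
  by linarith

lemma cantor_point_increasing:
  assumes "cell k u = cell k v" "digit k v < digit k u"
  shows "cantor_point u - cantor_point v \<ge> of_int (digit k u - digit k v) * spacing k - 3 * cell_size (Suc k)"
  using cantor_point_diff[OF assms(1)] tail_Suc[of k u] tail_Suc[of k v]
    offset_gap[OF digit_bounds(1)[of k v] assms(2) digit_bounds(2)[of k u]]
    tail_nonneg[of "Suc k" u] tail_le[of "Suc k" v] by linarith

lemma first_split:
  assumes "cell k u \<noteq> cell k v" "u \<in> {0..<1}" "v \<in> {0..<1}"
  shows "\<exists>j<k. cell j u = cell j v \<and> digit j u \<noteq> digit j v"
  using assms
proof (induction k)
  case 0
  then show ?case by (simp add: cell_0_iff[THEN iffD2])
next
  case (Suc k)
  then show ?case by (cases "cell k u = cell k v") (auto simp: cell_Suc less_Suc_eq)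
qed

text \<open>
  The offsets differ by at least one spacing per digit, and the later digits move each point by at most
  three sizes of a child, which is at most \<open>3/100\<close> of a spacing.
\<close>
lemma cantor_point_split_dist:
  assumes "cell k u = cell k v" "digit k u \<noteq> digit k v"
  shows "\<bar>cantor_point u - cantor_point v\<bar> \<ge> (97/100) * of_int \<bar>digit k u - digit k v\<bar> * spacing k"
proof -
  have *: "cantor_point u - cantor_point v \<ge> (97/100) * of_int \<bar>digit k u - digit k v\<bar> * spacing k"
    if c: "cell k u = cell k v" and d: "digit k v < digit k u" for u v
  proof -
    define X where "X = of_int (digit k u - digit k v) * spacing k"
    have "1 * spacing k \<le> X"
      unfolding X_def using d spacing_pos[of k] by (intro mult_right_mono) linarith+
    moreover have "(97/100) * of_int \<bar>digit k u - digit k v\<bar> * spacing k = (97/100) * X"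
      using d by (simp add: X_def)
    ultimately show ?thesis
      using cantor_point_increasing[OF c d, folded X_def] spacing_ge[of k] by linarith
  qed
  show ?thesis
  proof (cases "digit k v < digit k u")
    case True then show ?thesis by (rule order_trans[OF *[OF assms(1)] abs_ge_self])
  next
    case False then have "digit k u < digit k v" using assms(2) by simp
    from order_trans[OF *[OF assms(1)[symmetric] this] abs_ge_self] show ?thesis
      by (simp only: abs_minus_commute)
  qed
qed

text \<open>
  The images are already separated at the first generation in which the two parameters choose
  different children, and there by \<open>97/100\<close> of a spacing, hence by \<open>97\<close> sizes of a child. The numbers
  \<open>3\<close> and \<open>97\<close> of the two distance bounds leave room for the balls of radius \<open>16 * cell_size k\<close> that
  support the kernels: two points of the Cantor set in such a ball lie in one cell of generation \<open>k\<close>.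
\<close>
lemma cantor_point_separated:
  assumes "cell k u \<noteq> cell k v" "u \<in> {0..<1}" "v \<in> {0..<1}"
  shows "\<bar>cantor_point u - cantor_point v\<bar> \<ge> 97 * cell_size k"
proof -
  obtain j where j: "j < k" "cell j u = cell j v" "digit j u \<noteq> digit j v"
    using first_split[OF assms] by blast
  have "97 * cell_size k \<le> 97 * cell_size (Suc j)"
    using cell_size_antimono[of "Suc j" k] j(1) by simp
  also have "\<dots> \<le> (97/100) * 1 * spacing j" using spacing_ge[of j] by simp
  also have "\<dots> \<le> (97/100) * of_int \<bar>digit j u - digit j v\<bar> * spacing j"
    using j(3) spacing_pos[of j] by (intro mult_right_mono mult_left_mono) (auto simp: abs_if)
  also have "\<dots> \<le> \<bar>cantor_point u - cantor_point v\<bar>" by (rule cantor_point_split_dist[OF j(2,3)])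
  finally show ?thesis .
qed

lemma parameter_diff:
  assumes "cell k u = cell k v"
  shows "\<bar>u - v\<bar> < cell_mass k"
  using cell_diff_less[of u v k] assms by simp

lemma cell_eventually_distinct:
  assumes "u \<noteq> v" shows "\<exists>k. cell k u \<noteq> cell k v"
proof -
  have "eventually (\<lambda>k. cell_size k < (\<bar>u - v\<bar>)\<^sup>2) sequentially"
    using order_tendstoD(2)[OF cell_size_LIMSEQ, of "(\<bar>u - v\<bar>)\<^sup>2"] assms by simp
  then obtain k where "cell_size k < \<bar>u - v\<bar>\<^sup>2" by (auto simp: eventually_sequentially)
  then have "cell_mass k < \<bar>u - v\<bar>"
    unfolding cell_size_def by (rule power_less_imp_less_base) simp
  then show ?thesis using parameter_diff[of k u v] by force
qed

text \<open>
  Let \<open>k\<close> be the generation in which \<open>u\<close> and \<open>v\<close> separate, with digits that differ by \<open>d\<close>. Then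
  \<open>|u - v|\<close> is bounded both by the mass of the common cell and by \<open>2 d\<close> masses of a child. The
  product of these bounds is \<open>2 d\<close> spacings, since a spacing is exactly the mass of a cell times the mass
  of a child, and the images are at least \<open>97/100 \<cdot> d\<close> spacings apart. Multiplying the two bounds avoids
  a choice between them according to the distance.
\<close>
lemma cantor_point_inverse_Hoelder:
  assumes "u \<in> {0..<1}" "v \<in> {0..<1}"
  shows "(u - v)\<^sup>2 \<le> 3 * \<bar>cantor_point u - cantor_point v\<bar>"
proof (cases "u = v")
  case False
  obtain k where k: "cell k u = cell k v" "digit k u \<noteq> digit k v"
    using cell_eventually_distinct[OF False] first_split[OF _ assms] by blast
  define d :: real where "d = of_int \<bar>digit k u - digit k v\<bar>"
  have d: "d \<ge> 1" using k(2) by (auto simp: d_def abs_if)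
  have "\<bar>u - v\<bar> < (d + 1) * cell_mass (Suc k)"
    using cell_diff_less[of u v "Suc k"] k(1) by (simp add: cell_Suc d_def)
  also have "\<dots> \<le> 2 * d * cell_mass (Suc k)"
    using d cell_mass_pos[of "Suc k"] by (intro mult_right_mono) auto
  finally have 2: "\<bar>u - v\<bar> \<le> 2 * d * cell_mass (Suc k)" by simp
  have "(u - v)\<^sup>2 = \<bar>u - v\<bar> * \<bar>u - v\<bar>" by (simp add: power2_eq_square)
  also have "\<dots> \<le> cell_mass k * (2 * d * cell_mass (Suc k))"
    using parameter_diff[OF k(1)] 2 cell_mass_pos[of k] by (intro mult_mono) auto
  also have "\<dots> = 2 * (d * spacing k)" by (simp add: spacing_eq_mass)
  also have "\<dots> \<le> 3 * ((97/100) * d * spacing k)" using d spacing_pos[of k] by simp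
  also have "\<dots> \<le> 3 * \<bar>cantor_point u - cantor_point v\<bar>"
    unfolding d_def by (rule mult_left_mono[OF cantor_point_split_dist[OF k]]) simp
  finally show ?thesis .
qed simp

definition stray :: "nat \<Rightarrow> real \<Rightarrow> bool" where
  "stray k u \<longleftrightarrow> u \<in> {0..<1} \<and> digit k u = int (branching k) - 1"

text \<open>
  The surplus of four child sizes over \<open>cell_size k\<close> lets the estimate survive a move of the centre away
  from the Cantor set, as needed for the open neighbourhood \<open>stray_set\<close> below.
\<close>
lemma stray_isolated:
  assumes "stray k u" "v \<in> {0..<1}" "cell (Suc k) v \<noteq> cell (Suc k) u"
  shows "\<bar>cantor_point u - cantor_point v\<bar> \<ge> cell_size k + 4 * cell_size (Suc k)"
proof (cases "cell k u = cell k v")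
  case True
  have a: "digit k v < int (branching k) - 1"
    using assms True digit_bounds(2)[of k v] by (auto simp: stray_def cell_Suc)
  have "of_int (digit k v) * spacing k \<le> (real (branching k) - 2) * spacing k"
    using a spacing_pos[of k] by (intro mult_right_mono) linarith+
  then have o: "offset k (digit k v) \<le> cell_size k - 2 * spacing k"
    using a cell_size_eq[of k] by (simp add: offset_def algebra_simps)
  have "offset k (digit k u) = 2 * cell_size k" using assms(1) by (simp add: stray_def offset_def)
  then show ?thesis
    using cantor_point_diff[OF True] tail_Suc[of k u] tail_Suc[of k v] o spacing_ge[of k] cell_size_pos[of "Suc k"]
      tail_nonneg[of "Suc k" u] tail_le[of "Suc k" v] by linarith
next
  case False
  then show ?thesis using cantor_point_separated[of k u v] assms cell_size_Suc_le[of k] cell_size_pos[of k]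
      cell_size_pos[of "Suc k"]
    by (simp add: stray_def)
qed

text \<open>
  The parameter interval of length \<open>\<eta> * cell_mass k\<close> just before the stray child consists of the part
  of the cluster nearest to it. Here \<open>\<eta> \<le> 1/2\<close> keeps it inside the cell. The error
  \<open>3 / branching k\<close> comes from the discreteness of the cluster and the sizes of the children; it is the
  reason why only large \<open>k\<close> are of use when \<open>\<beta>\<close> is close to \<open>1\<close>.
\<close>
lemma stray_near_cluster:
  assumes u: "stray k u" and \<eta>: "0 < \<eta>" "\<eta> \<le> 1/2"
    and v: "v \<in> {of_int (cell (Suc k) u) * cell_mass (Suc k) - \<eta> * cell_mass k
               ..< of_int (cell (Suc k) u) * cell_mass (Suc k)}"
  shows "cell k v = cell k u"
    "\<bar>cantor_point u - cantor_point v\<bar> \<le> cell_size k * (1 + \<eta> + 3 / real (branching k))"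
proof -
  let ?N = "real (branching k)"
  let ?c = "of_int (cell (Suc k) u) :: real"
  have N: "?N \<ge> 100" by (rule branching_ge)
  have mass: "cell_mass k = ?N * cell_mass (Suc k)" using N by (simp add: cell_mass_Suc)
  have c: "?c = of_int (cell k u) * ?N + ?N - 1"
    using u by (simp add: stray_def cell_Suc)
  have "?N / 2 * cell_mass (Suc k) \<le> (?N - 1) * cell_mass (Suc k)"
    using N cell_mass_pos[of "Suc k"] by (intro mult_right_mono) auto
  moreover have "\<eta> * cell_mass k \<le> 1/2 * cell_mass k"
    using \<eta> cell_mass_pos[of k] by (intro mult_right_mono) auto
  ultimately have "\<eta> * cell_mass k \<le> (?N - 1) * cell_mass (Suc k)" using mass by simp
  then show same: "cell k v = cell k u"
    using v cell_mass_pos[of "Suc k"] unfolding cell_iff mass c by (simp add: algebra_simps)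
  have "(?c - \<eta> * ?N) * cell_mass (Suc k) \<le> v" using v mass by (simp add: algebra_simps)
  also have "v < (of_int (cell (Suc k) v) + 1) * cell_mass (Suc k)"
    using cell_iff[of "Suc k" v "cell (Suc k) v"] by simp
  finally have "?c - \<eta> * ?N < of_int (cell (Suc k) v) + 1"
    using cell_mass_pos[of "Suc k"] by (simp add: mult_less_cancel_right)
  then have dv: "?N - 2 - \<eta> * ?N \<le> of_int (digit k v)"
    using u same unfolding c cell_Suc by (simp add: algebra_simps stray_def)
  have ov: "(?N - 2 - \<eta> * ?N) * spacing k \<le> offset k (digit k v)"
  proof -
    have "(?N - 2 - \<eta> * ?N) * spacing k \<le> of_int (digit k v) * spacing k"
      using dv spacing_pos[of k] by (intro mult_right_mono) auto
    moreover have "(?N - 2 - \<eta> * ?N) * spacing k \<le> ?N * spacing k"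
      using \<eta> N spacing_pos[of k] mult_nonneg_nonneg[of \<eta> ?N] by (intro mult_right_mono) linarith+
    ultimately show ?thesis using cell_size_eq[of k] cell_size_pos[of k]
      by (auto simp: offset_def)
  qed
  have ou: "offset k (digit k u) = 2 * cell_size k" using u by (simp add: stray_def offset_def)
  have "digit k v \<noteq> digit k u"
    using same v cell_mass_pos[of "Suc k"] cell_iff[of "Suc k" v "cell (Suc k) u"] by (auto simp: cell_Suc)
  then have "cell (Suc k) v \<noteq> cell (Suc k) u" using same by (simp add: cell_Suc)
  have diff: "cantor_point u - cantor_point v
      = offset k (digit k u) - offset k (digit k v) + tail (Suc k) u - tail (Suc k) v"
    using cantor_point_diff[OF same[symmetric]] tail_Suc[of k u] tail_Suc[of k v] by simp
  have "(?N - 2 - \<eta> * ?N) * spacing k = cell_size k - 2 * spacing k - \<eta> * cell_size k"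
    using cell_size_eq[of k] by (simp add: algebra_simps)
  moreover have "cell_size k * (1 + \<eta> + 3 / ?N) = cell_size k + \<eta> * cell_size k + 3 * spacing k"
    by (simp add: spacing_def algebra_simps)
  moreover have "offset k (digit k v) \<le> 2 * cell_size k" by (rule offset_bounds[OF digit_bounds])
  ultimately show "\<bar>cantor_point u - cantor_point v\<bar> \<le> cell_size k * (1 + \<eta> + 3 / ?N)"
    using diff ou ov tail_nonneg[of "Suc k" u] tail_nonneg[of "Suc k" v] tail_le[of "Suc k" u]
      tail_le[of "Suc k" v] spacing_ge[of k] cell_size_pos[of k] cell_size_pos[of "Suc k"]
      cell_size_ge[of k] spacing_pos[of k] mult_nonneg_nonneg[of \<eta> "cell_size k"] \<eta> unfolding abs_le_iff by linarith
qed

section \<open>The Cantor measure and its growth\<close>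
definition cantor_measure :: "real measure" where
  "cantor_measure = distr (restrict_space lborel {0..<1}) borel cantor_point"

lemma measurable_cantor_point [measurable]: "cantor_point \<in> borel_measurable borel"
proof -
  have [measurable]: "cell k \<in> borel \<rightarrow>\<^sub>M count_space UNIV" for k
    unfolding cell_def by measurable
  have [measurable]: "digit k \<in> borel \<rightarrow>\<^sub>M count_space UNIV" for k
    unfolding digit_def by measurable
  have "(\<lambda>u. offset k (digit k u)) \<in> borel_measurable borel" for k
    by measurable
  then show ?thesis unfolding cantor_point_def [abs_def] by measurable
qed

lemma sets_cantor_measure [simp, measurable_cong]: "sets cantor_measure = sets borel"
  by (simp add: cantor_measure_def)

lemma space_cantor_measure [simp]: "space cantor_measure = UNIV"
  by (simp add: cantor_measure_def)

lemma emeasure_cantor_measure: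
  assumes "S \<in> sets borel"
  shows "emeasure cantor_measure S = emeasure lborel {u \<in> {0..<1}. cantor_point u \<in> S}"
proof -
  have 1: "cantor_point \<in> restrict_space lborel {0..<1} \<rightarrow>\<^sub>M borel"
    by (intro measurable_restrict_space1) simp
  have "emeasure cantor_measure S
      = emeasure (restrict_space lborel {0..<1}) (cantor_point -` S \<inter> {0..<1})"
    unfolding cantor_measure_def
    by (subst emeasure_distr[OF 1 assms]) (simp add: space_restrict_space)
  also have "\<dots> = emeasure lborel (cantor_point -` S \<inter> {0..<1})"
    by (rule emeasure_restrict_space) auto
  finally show ?thesis by (simp add: vimage_def Int_def conj_commute)
qed

lemma prob_space_cantor_measure: "prob_space cantor_measure"
proof
  have "{u \<in> {0..<1}. cantor_point u \<in> UNIV} = {0..<1::real}" by auto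
  then show "emeasure cantor_measure (space cantor_measure) = 1"
    by (simp add: emeasure_cantor_measure)
qed

interpretation cantor: prob_space cantor_measure
  by (rule prob_space_cantor_measure)

text \<open>Upper bounds for masses of sets of points follow from the diameter of the set of parameters.\<close>
lemma cantor_measure_le:
  assumes S: "S \<in> sets borel" and "0 \<le> d"
    and d: "\<And>u v. \<lbrakk>u \<in> {0..<1}; v \<in> {0..<1}; cantor_point u \<in> S; cantor_point v \<in> S\<rbrakk> \<Longrightarrow> \<bar>u - v\<bar> \<le> d"
  shows "emeasure cantor_measure S \<le> ennreal (2 * d)"
proof (cases "{u \<in> {0..<1}. cantor_point u \<in> S} = {}")
  case True
  then show ?thesis by (simp only: emeasure_cantor_measure[OF S]) simp
next
  case False
  then obtain w where w: "w \<in> {0..<1}" "cantor_point w \<in> S" by blast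
  have "{u \<in> {0..<1}. cantor_point u \<in> S} \<subseteq> {w - d..w + d}"
    using d[OF w(1) _ w(2)] by (force simp: abs_le_iff)
  then have "emeasure cantor_measure S \<le> emeasure lborel {w - d..w + d}"
    unfolding emeasure_cantor_measure[OF S] by (rule emeasure_mono) simp
  also have "\<dots> = ennreal (2 * d)" using \<open>0 \<le> d\<close> by simp
  finally show ?thesis .
qed

lemma cantor_measure_ge:
  assumes S: "S \<in> sets borel" and "a \<le> b"
    and sub: "\<And>u. u \<in> {a..<b} \<Longrightarrow> u \<in> {0..<1} \<and> cantor_point u \<in> S"
  shows "emeasure cantor_measure S \<ge> ennreal (b - a)"
proof -
  have [measurable]: "S \<in> sets borel" by fact
  have "ennreal (b - a) = emeasure lborel {a..<b}" using \<open>a \<le> b\<close> by simp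
  also have "\<dots> \<le> emeasure lborel {u \<in> {0..<1}. cantor_point u \<in> S}"
    using sub by (intro emeasure_mono) auto
  finally show ?thesis by (simp add: emeasure_cantor_measure[OF S])
qed

lemma cantor_measure_ball_le:
  assumes "0 < r"
  shows "emeasure cantor_measure (ball x r) \<le> ennreal (2 * sqrt (6 * r))"
proof (rule cantor_measure_le)
  fix u v assume uv: "u \<in> {0..<1}" "v \<in> {0..<1}" "cantor_point u \<in> ball x r" "cantor_point v \<in> ball x r"
  have "(u - v)\<^sup>2 \<le> 6 * r"
    using cantor_point_inverse_Hoelder[OF uv(1,2)] uv(3,4) unfolding mem_ball dist_real_def by argo
  then show "\<bar>u - v\<bar> \<le> sqrt (6 * r)" by (rule real_le_rsqrt[of "\<bar>u - v\<bar>", simplified])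
qed (use assms in auto)

lemma growth_cantor_measure: "growth_condition cantor_measure (1/2)"
  unfolding growth_condition_def
proof (intro exI[of _ "2 * sqrt 6"] allI impI)
  fix x r :: real assume r: "0 < r"
  have "measure cantor_measure (ball x r) \<le> 2 * sqrt (6 * r)"
    using cantor_measure_ball_le[OF r, of x] r
    by (simp add: cantor.emeasure_eq_measure)
  then show "measure cantor_measure (ball x r) \<le> 2 * sqrt 6 * r powr (1/2)"
    using r by (simp add: powr_half_sqrt real_sqrt_mult)
qed

section \<open>Masses near the stray children\<close>

text \<open>
  A union of open balls about the images of the stray parameters is used in place of the image itself, since it is
  obviously a Borel set. By separation it contains no further points of the Cantor set
  (\<open>stray_of_stray_set\<close>).
\<close>
definition stray_set :: "nat \<Rightarrow> real set" where
  "stray_set k = (\<Union>u \<in> Collect (stray k). ball (cantor_point u) (4 * cell_size (Suc k)))"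

lemma stray_set_borel [measurable]: "stray_set k \<in> sets borel"
  unfolding stray_set_def by (intro borel_open open_UN) auto

lemma stray_set_center:
  assumes "y \<in> stray_set k"
  obtains u where "stray k u" "\<bar>cantor_point u - y\<bar> < 4 * cell_size (Suc k)"
  using assms by (auto simp: stray_set_def dist_real_def)

lemma stray_of_stray_set:
  assumes "v \<in> {0..<1}" "cantor_point v \<in> stray_set k"
  shows "stray k v"
proof -
  obtain u where u: "stray k u" "\<bar>cantor_point u - cantor_point v\<bar> < 4 * cell_size (Suc k)"
    using stray_set_center[OF assms(2)] .
  have "cell (Suc k) u = cell (Suc k) v"
    using cantor_point_separated[of "Suc k" u v] u assms(1) cell_size_pos[of "Suc k"]
    by (force simp: stray_def)
  then show ?thesis using digit_eq_of_cell[of "Suc k" u v k] u(1) assms(1) by (simp add: stray_def)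
qed

text \<open>The first gain of a factor \<open>1 / branching k\<close>: such a ball meets at most one child.\<close>
lemma stray_set_isolated:
  assumes "y \<in> stray_set k" "t \<le> cell_size k"
  shows "emeasure cantor_measure (ball y t) \<le> ennreal (2 * cell_mass (Suc k))"
proof (rule cantor_measure_le)
  obtain w where w: "stray k w" "\<bar>cantor_point w - y\<bar> < 4 * cell_size (Suc k)"
    using stray_set_center[OF assms(1)] .
  have cw: "cell (Suc k) v = cell (Suc k) w" if "v \<in> {0..<1}" "cantor_point v \<in> ball y t" for v
    using stray_isolated[OF w(1) that(1)] that(2) w(2) assms(2) unfolding mem_ball dist_real_def by linarith
  fix u v assume "u \<in> {0..<1}" "v \<in> {0..<1}" "cantor_point u \<in> ball y t" "cantor_point v \<in> ball y t"
  then show "\<bar>u - v\<bar> \<le> cell_mass (Suc k)"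
    using parameter_diff[of "Suc k" u v] cw by simp
qed (use cell_mass_pos[of "Suc k"] in auto)

text \<open>
  The second gain: the ball meets only one cell of generation \<open>k\<close>, and this cell has only one stray child.
\<close>
lemma stray_set_local_mass:
  "emeasure cantor_measure (stray_set k \<inter> ball z (16 * cell_size k)) \<le> ennreal (2 * cell_mass (Suc k))"
proof (rule cantor_measure_le)
  fix u v assume u: "u \<in> {0..<1}" "cantor_point u \<in> stray_set k \<inter> ball z (16 * cell_size k)"
    and v: "v \<in> {0..<1}" "cantor_point v \<in> stray_set k \<inter> ball z (16 * cell_size k)"
  have "cell k u = cell k v"
    using cantor_point_separated[of k u v] u v cell_size_pos[of k]
    unfolding Int_iff mem_ball dist_real_def by argo
  then have "cell (Suc k) u = cell (Suc k) v"
    using stray_of_stray_set[of u k] stray_of_stray_set[of v k] u v by (simp add: cell_Suc stray_def)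
  then show "\<bar>u - v\<bar> \<le> cell_mass (Suc k)" using parameter_diff[of "Suc k" u v] by simp
qed (use cell_mass_pos[of "Suc k"] in auto)

text \<open>Each of the \<open>cells k\<close> cells contributes the mass of one child.\<close>
lemma stray_set_mass: "emeasure cantor_measure (stray_set k) \<ge> ennreal (1 / real (branching k))"
proof -
  let ?N = "int (branching k)"
  let ?m = "cell_mass (Suc k)"
  define I where "I j = {u. cell (Suc k) u = int j * ?N + (?N - 1)}" for j :: nat
  have I: "I j = {of_int (int j * ?N + (?N - 1)) * ?m ..< (of_int (int j * ?N + (?N - 1)) + 1) * ?m}" for j
    by (auto simp: I_def cell_iff)
  have N: "?N \<ge> 100" using branching_ge[of k] by simp
  have cell_I: "cell k u = int j" "digit k u = ?N - 1" if "u \<in> I j" for u j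
  proof -
    have "cell (Suc k) u = (?N - 1) + int j * ?N" using that by (simp add: I_def)
    then show c: "cell k u = int j"
      unfolding cell_div[of k u, symmetric] using N by simp
    show "digit k u = ?N - 1"
      using cell_Suc[of k u] that by (simp add: I_def c)
  qed
  have eI: "emeasure lborel (I j) = ennreal ?m" for j
    using cell_mass_pos[of "Suc k"] unfolding I by (subst emeasure_lborel_Ico) (auto simp: algebra_simps)
  have "ennreal (1 / real (branching k)) = ennreal (real (cells k) * ?m)"
    using cells_pos[of k] by (simp add: cell_mass_def cells_Suc)
  also have "\<dots> = (\<Sum>j<cells k. emeasure lborel (I j))"
    using cell_mass_pos[of "Suc k"] by (simp add: eI ennreal_mult ennreal_of_nat_eq_real_of_nat)
  also have "\<dots> = emeasure lborel (\<Union>j<cells k. I j)"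
  proof (rule sum_emeasure)
    show "disjoint_family_on I {..<cells k}"
      unfolding disjoint_family_on_def using cell_I(1) by (metis disjoint_iff of_nat_eq_iff)
  qed (auto simp: I)
  also have "\<dots> \<le> emeasure lborel {u \<in> {0..<1}. cantor_point u \<in> stray_set k}"
  proof (intro emeasure_mono subsetI)
    fix u assume "u \<in> (\<Union>j<cells k. I j)"
    then obtain j where j: "j < cells k" "u \<in> I j" by auto
    have "real j * cell_mass k \<le> u" "u < (real j + 1) * cell_mass k"
      using cell_I(1)[OF j(2)] by (simp_all add: cell_iff)
    moreover have "(real j + 1) * cell_mass k \<le> real (cells k) * cell_mass k"
      using j(1) cell_mass_pos[of k] by (intro mult_right_mono) auto
    moreover have "real (cells k) * cell_mass k = 1" using cells_pos[of k] by (simp add: cell_mass_def)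
    moreover have "0 \<le> real j * cell_mass k" using cell_mass_pos[of k] by simp
    ultimately have u: "u \<in> {0..<1}" by simp
    then have "stray k u" using cell_I(2)[OF j(2)] by (simp add: stray_def)
    then show "u \<in> {u \<in> {0..<1}. cantor_point u \<in> stray_set k}"
      using u cell_size_pos[of "Suc k"] by (force simp: stray_set_def)
  qed measurable
  finally show ?thesis by (simp add: emeasure_cantor_measure)
qed

lemma same_cell_unit: "cell k u = cell k v \<Longrightarrow> u \<in> {0..<1} \<Longrightarrow> v \<in> {0..<1}"
  using cell_eq_mono[of k u v 0] cell_0_iff[of u] cell_0_iff[of v] by simp

text \<open>
  Such a ball contains the part of the cluster described in \<open>stray_near_cluster\<close>. The constant has
  increased from \<open>3\<close> to \<open>4\<close> because \<open>y\<close> may differ from a point of the Cantor set by four child sizes.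
\<close>
lemma stray_set_enlarged_ball_mass:
  assumes y: "y \<in> stray_set k" and \<eta>: "0 < \<eta>" "\<eta> \<le> 1/2"
    and r: "cell_size k * (1 + \<eta> + 4 / real (branching k)) \<le> r"
  shows "emeasure cantor_measure (ball y r) \<ge> ennreal (\<eta> * cell_mass k)"
proof -
  obtain w where w: "stray k w" "\<bar>cantor_point w - y\<bar> < 4 * cell_size (Suc k)"
    using stray_set_center[OF y] .
  let ?c = "of_int (cell (Suc k) w) * cell_mass (Suc k)"
  have "ennreal (?c - (?c - \<eta> * cell_mass k)) \<le> emeasure cantor_measure (ball y r)"
  proof (rule cantor_measure_ge)
    fix v assume v: "v \<in> {?c - \<eta> * cell_mass k..<?c}"
    have "\<bar>cantor_point w - cantor_point v\<bar> \<le> cell_size k * (1 + \<eta> + 3 / real (branching k))"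
      by (rule stray_near_cluster[OF w(1) \<eta> v])
    also have "\<dots> = cell_size k * (1 + \<eta> + 4 / real (branching k)) - spacing k"
      by (simp add: spacing_def algebra_simps)
    finally have "cantor_point v \<in> ball y r"
      using w(2) r spacing_ge[of k] cell_size_pos[of "Suc k"] unfolding mem_ball dist_real_def by argo
    then show "v \<in> {0..<1} \<and> cantor_point v \<in> ball y r"
      using same_cell_unit[of k w v] stray_near_cluster(1)[OF w(1) \<eta> v] w(1) by (simp add: stray_def)
  qed (use \<eta> cell_mass_pos[of k] in auto)
  then show ?thesis by simp
qed

lemma stray_set_cell_mass:
  assumes y: "y \<in> stray_set k"
  shows "emeasure cantor_measure (cball y (4 * cell_size k)) \<ge> ennreal (cell_mass k)"
proof -
  obtain w where w: "stray k w" "\<bar>cantor_point w - y\<bar> < 4 * cell_size (Suc k)"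
    using stray_set_center[OF y] .
  let ?c = "of_int (cell k w) :: real"
  have "ennreal ((?c + 1) * cell_mass k - ?c * cell_mass k) \<le> emeasure cantor_measure (cball y (4 * cell_size k))"
  proof (rule cantor_measure_ge)
    fix v assume "v \<in> {?c * cell_mass k..<(?c + 1) * cell_mass k}"
    then have v: "cell k w = cell k v" using cell_iff[of k v "cell k w"] by simp
    have "cantor_point v \<in> cball y (4 * cell_size k)"
      using cantor_point_close[OF v] w(2) cell_size_Suc_le[of k] cell_size_pos[of k]
      unfolding mem_cball dist_real_def by argo
    then show "v \<in> {0..<1} \<and> cantor_point v \<in> cball y (4 * cell_size k)"
      using same_cell_unit[OF v] w(1) by (simp add: stray_def)
  qed (use cell_mass_pos[of k] in auto)
  then show ?thesis by (simp add: algebra_simps)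
qed

section \<open>The energy of a square function\<close>
lemma esqrt_measurable [measurable]: "esqrt \<in> borel_measurable borel"
  unfolding esqrt_def [abs_def] by measurable

lemma esqrt_square: "(esqrt a)\<^sup>2 = a"
  by (cases a) (auto simp: esqrt_def power2_eq_square ennreal_mult[symmetric] ennreal_mult_top)

lemma esqrt_mono: "a \<le> b \<Longrightarrow> esqrt a \<le> esqrt b"
  by (cases a; cases b) (auto simp: esqrt_def top_unique)

lemma esqrt_mult_le:
  assumes "0 \<le> C" shows "esqrt (ennreal C * a) \<le> ennreal (sqrt C) * esqrt a"
  using assms
  by (cases a) (auto simp: esqrt_def ennreal_mult[symmetric] real_sqrt_mult ennreal_mult_top)

lemma measurable_theta:
  assumes "sigma_finite_measure \<mu>" and [measurable_cong]: "sets \<mu> = sets borel"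
    and [measurable]: "(\<lambda>(t, x, y). s t x y) \<in> borel_measurable borel" "f \<in> borel_measurable \<mu>"
  shows "(\<lambda>(t, y). theta \<mu> s t f y) \<in> borel_measurable (lborel \<Otimes>\<^sub>M \<mu>)"
proof -
  interpret sigma_finite_measure \<mu> by fact
  have [measurable]: "(\<lambda>(t, x, y). s t x y) \<in> borel_measurable (borel \<Otimes>\<^sub>M borel \<Otimes>\<^sub>M borel)"
    using assms(3) by (simp add: borel_prod)
  have [measurable]: "(\<lambda>q. s (fst (fst q)) (snd (fst q)) (snd q)) \<in> borel_measurable ((lborel \<Otimes>\<^sub>M \<mu>) \<Otimes>\<^sub>M \<mu>)"
    using measurable_compose[of "\<lambda>q. (fst (fst q), snd (fst q), snd q)" "(lborel \<Otimes>\<^sub>M \<mu>) \<Otimes>\<^sub>M \<mu>"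
        "borel \<Otimes>\<^sub>M borel \<Otimes>\<^sub>M borel" "\<lambda>(t, x, y). s t x y"] by simp
  have "(\<lambda>(p, y). s (fst p) (snd p) y * f y) \<in> borel_measurable ((lborel \<Otimes>\<^sub>M \<mu>) \<Otimes>\<^sub>M \<mu>)"
    by measurable
  then show ?thesis
    unfolding theta_def using borel_measurable_lebesgue_integral[of "\<lambda>p y. s (fst p) (snd p) y * f y" "lborel \<Otimes>\<^sub>M \<mu>"]
    by (simp add: case_prod_beta')
qed

text \<open>
  For fixed \<open>(y, t)\<close> the points \<open>x\<close> whose cone contains \<open>(y, t)\<close> form the ball of radius \<open>\<beta> t\<close> about \<open>y\<close>.
\<close>
lemma square_fun_Tonelli:
  assumes "sigma_finite_measure \<mu>" and [measurable_cong, simp]: "sets \<mu> = sets borel"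
    and s: "(\<lambda>(t, x, y). s t x y) \<in> borel_measurable borel" and f: "f \<in> borel_measurable \<mu>"
  shows "square_fun \<mu> m s \<beta> f \<in> borel_measurable \<mu>"
    and "(\<integral>\<^sup>+x. (square_fun \<mu> m s \<beta> f x)\<^sup>2 \<partial>\<mu>) =
      (\<integral>\<^sup>+t\<in>{0<..}. (\<integral>\<^sup>+y. emeasure \<mu> (ball y (\<beta> * t)) *
          ennreal ((cmod (theta \<mu> s t f y))\<^sup>2 / t powr (m + 1)) \<partial>\<mu>) \<partial>lborel)"
proof -
  interpret sigma_finite_measure \<mu> by fact
  interpret pair: pair_sigma_finite \<mu> "lborel :: real measure" ..
  interpret pair2: pair_sigma_finite \<mu> "\<mu> \<Otimes>\<^sub>M (lborel :: real measure)"
    by (intro pair_sigma_finite.intro pair.sigma_finite_measure_axioms) unfold_locales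
  have space: "space \<mu> = UNIV" using sets_eq_imp_space_eq[OF assms(2)] by simp
  define W where "W p = ennreal ((cmod (theta \<mu> s (snd p) f (fst p)))\<^sup>2 / snd p powr (m + 1))" for p
  have [measurable]: "(\<lambda>p. theta \<mu> s (fst p) f (snd p)) \<in> borel_measurable (lborel \<Otimes>\<^sub>M \<mu>)"
    using measurable_theta[OF assms(1,2) s f] by (simp add: case_prod_beta')
  have "(\<lambda>p. theta \<mu> s (snd p) f (fst p)) \<in> borel_measurable (\<mu> \<Otimes>\<^sub>M lborel)"
    using measurable_compose[OF measurable_pair_swap' \<open>(\<lambda>p. theta \<mu> s (fst p) f (snd p)) \<in> _\<close>]
    by (simp add: case_prod_beta')
  then have [measurable]: "W \<in> borel_measurable (\<mu> \<Otimes>\<^sub>M lborel)"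
    unfolding W_def [abs_def] by measurable
  have cone: "indicator (cone \<beta> x) p = indicator {q. 0 < snd (snd q) \<and> \<bar>fst (snd q) - fst q\<bar> < \<beta> * snd (snd q)} (x, p)" for x p
    by (auto simp: cone_def indicator_def)
  have Wc: "(\<lambda>(x, p). W p * indicator (cone \<beta> x) p) \<in> borel_measurable (\<mu> \<Otimes>\<^sub>M (\<mu> \<Otimes>\<^sub>M lborel))"
    unfolding cone by measurable
  have S: "square_fun \<mu> m s \<beta> f x = esqrt (\<integral>\<^sup>+p. W p * indicator (cone \<beta> x) p \<partial>(\<mu> \<Otimes>\<^sub>M lborel))" for x
    by (simp add: square_fun_def W_def case_prod_beta')
  have "(\<lambda>x. \<integral>\<^sup>+p. W p * indicator (cone \<beta> x) p \<partial>(\<mu> \<Otimes>\<^sub>M lborel)) \<in> borel_measurable \<mu>"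
    using pair.borel_measurable_nn_integral[OF Wc] by simp
  then show "square_fun \<mu> m s \<beta> f \<in> borel_measurable \<mu>"
    unfolding S[abs_def] by measurable
  have cone_ball: "indicator (cone \<beta> x) (y, t) = (indicator {0<..} t * indicator (ball y (\<beta> * t)) x :: ennreal)" for x y t
    by (auto simp: cone_def indicator_def dist_real_def)
  have mass: "(\<integral>\<^sup>+x. indicator (cone \<beta> x) (y, t) \<partial>\<mu>) = indicator {0<..} t * emeasure \<mu> (ball y (\<beta> * t))" for y t
    by (simp add: cone_ball nn_integral_cmult_indicator)
  have "(\<integral>\<^sup>+x. (square_fun \<mu> m s \<beta> f x)\<^sup>2 \<partial>\<mu>)
      = (\<integral>\<^sup>+x. \<integral>\<^sup>+p. W p * indicator (cone \<beta> x) p \<partial>(\<mu> \<Otimes>\<^sub>M lborel) \<partial>\<mu>)"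
    by (simp add: S esqrt_square)
  also have "\<dots> = (\<integral>\<^sup>+p. \<integral>\<^sup>+x. W p * indicator (cone \<beta> x) p \<partial>\<mu> \<partial>(\<mu> \<Otimes>\<^sub>M lborel))"
    using pair2.Fubini'[OF Wc] by simp
  also have "\<dots> = (\<integral>\<^sup>+p. W p * (indicator {0<..} (snd p) * emeasure \<mu> (ball (fst p) (\<beta> * snd p))) \<partial>(\<mu> \<Otimes>\<^sub>M lborel))"
  proof (rule nn_integral_cong)
    fix p :: "real \<times> real"
    obtain y t where p: "p = (y, t)" by (cases p)
    have [measurable]: "ball y (\<beta> * t) \<in> sets \<mu>" by simp
    have "(\<lambda>x. indicator (cone \<beta> x) p :: ennreal) \<in> borel_measurable \<mu>"
      unfolding p cone_ball by measurable
    then show "(\<integral>\<^sup>+x. W p * indicator (cone \<beta> x) p \<partial>\<mu>)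
      = W p * (indicator {0<..} (snd p) * emeasure \<mu> (ball (fst p) (\<beta> * snd p)))"
      using mass[of "fst p" "snd p"] by (simp add: nn_integral_cmult)
  qed
  also have "\<dots> = (\<integral>\<^sup>+t. \<integral>\<^sup>+y. W (y, t) * (indicator {0<..} t * emeasure \<mu> (ball y (\<beta> * t))) \<partial>\<mu> \<partial>lborel)"
  proof (subst pair.nn_integral_snd[symmetric])
    have ball: "Pair p -` {q. \<bar>fst (fst q) - snd q\<bar> < \<beta> * snd (fst q)} = ball (fst p) (\<beta> * snd p)" for p
      by (auto simp: dist_real_def)
    have "{q \<in> space ((\<mu> \<Otimes>\<^sub>M lborel) \<Otimes>\<^sub>M \<mu>). \<bar>fst (fst q) - snd q\<bar> < \<beta> * snd (fst q)} \<in> sets ((\<mu> \<Otimes>\<^sub>M lborel) \<Otimes>\<^sub>M \<mu>)"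
      by measurable
    then have "{q. \<bar>fst (fst q) - snd q\<bar> < \<beta> * snd (fst q)} \<in> sets ((\<mu> \<Otimes>\<^sub>M lborel) \<Otimes>\<^sub>M \<mu>)"
      by (simp add: space_pair_measure space)
    from measurable_emeasure_Pair[OF this]
    have [measurable]: "(\<lambda>p. emeasure \<mu> (ball (fst p) (\<beta> * snd p))) \<in> borel_measurable (\<mu> \<Otimes>\<^sub>M lborel)"
      unfolding ball .
    show "(\<lambda>p. W p * (indicator {0<..} (snd p) * emeasure \<mu> (ball (fst p) (\<beta> * snd p)))) \<in> borel_measurable (\<mu> \<Otimes>\<^sub>M lborel)"
      by measurable
  qed simp
  also have "\<dots> = (\<integral>\<^sup>+t\<in>{0<..}. (\<integral>\<^sup>+y. emeasure \<mu> (ball y (\<beta> * t)) *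
          ennreal ((cmod (theta \<mu> s t f y))\<^sup>2 / t powr (m + 1)) \<partial>\<mu>) \<partial>lborel)"
    by (intro nn_integral_cong) (auto simp: W_def indicator_def mult.commute)
  finally show "(\<integral>\<^sup>+x. (square_fun \<mu> m s \<beta> f x)\<^sup>2 \<partial>\<mu>) = \<dots>" .
qed

section \<open>The kernels\<close>
definition active :: "(real \<times> real) set" where
  "active = (\<Union>k. stray_set k \<times> {cell_size k / 2..cell_size k})"

text \<open>
  Suppose that \<open>t\<close> lies between \<open>cell_size k / 2\<close> and \<open>cell_size k\<close> and the centre \<open>x\<close> in \<open>stray_set k\<close>.
  The width \<open>16 t\<close> ensures that the bump is at least half of its maximum on the whole cell of
  generation \<open>k\<close> around \<open>x\<close>, while its support meets no other cell of this generation.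
\<close>
definition bump :: "real \<Rightarrow> real \<Rightarrow> real \<Rightarrow> real" where
  "bump t x y = max 0 (1 - \<bar>x - y\<bar> / (16 * t)) / sqrt t"

definition switched_bump :: "real \<Rightarrow> real \<Rightarrow> real \<Rightarrow> complex" where
  "switched_bump t x y = complex_of_real (indicator active (x, t) * bump t x y)"

lemma active_measurable [measurable]: "active \<in> sets (borel \<Otimes>\<^sub>M borel)"
  unfolding active_def by (intro sets.countable_UN) auto

lemma measurable_bump [measurable]:
  assumes [measurable]: "a \<in> borel_measurable M" "b \<in> borel_measurable M" "c \<in> borel_measurable M"
  shows "(\<lambda>p. bump (a p) (b p) (c p)) \<in> borel_measurable M"
  unfolding bump_def by measurable

lemma measurable_switched_bump: "(\<lambda>(t, x, y). switched_bump t x y) \<in> borel_measurable borel"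
proof -
  have "(\<lambda>(t, x, y). switched_bump t x y) \<in> borel_measurable (borel \<Otimes>\<^sub>M borel \<Otimes>\<^sub>M borel)"
    unfolding switched_bump_def by measurable
  then show ?thesis by (simp add: borel_prod)
qed

lemma measurable_kernels_switched_bump: "measurable_kernels switched_bump"
  unfolding measurable_kernels_def by (intro measurable_restrict_space1 measurable_switched_bump)

lemma norm_switched_bump: "cmod (switched_bump t x y) = indicator active (x, t) * \<bar>bump t x y\<bar>"
  unfolding switched_bump_def norm_of_real by (simp add: abs_mult)

lemma bump_bounds: assumes "t > 0"
  shows "0 \<le> bump t x y" "bump t x y \<le> indicator (ball x (16 * t)) y / sqrt t"
  using assms by (auto simp: bump_def indicator_def dist_real_def intro!: divide_right_mono)

lemma half_power: assumes "(t::real) > 0" shows "t powr (1/2 + 1) = t * sqrt t"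
  unfolding powr_add using assms by (simp add: powr_half_sqrt)

text \<open>
  On its support the bump lives at scale \<open>t\<close>, so the decay factor may be replaced by a power of \<open>t\<close>. The
  bound \<open>17 t\<close> rather than \<open>16 t\<close> allows for a perturbation of \<open>y\<close> by \<open>t/2\<close> in the smoothness
  condition.
\<close>
lemma kernel_tail_bound:
  assumes "t > 0" "\<bar>x - y\<bar> \<le> 17 * t" "d \<ge> 0"
  shows "d / (t * sqrt t) \<le> 18 powr (1/2 + 1) * (d / (t + \<bar>x - y\<bar>) powr (1/2 + 1))"
proof -
  have "(t + \<bar>x - y\<bar>) powr (1/2 + 1) \<le> (18 * t) powr (1/2 + 1)"
    using assms by (intro powr_mono2) auto
  also have "\<dots> = 18 powr (1/2 + 1) * (t * sqrt t)"
    using assms half_power[of t] by (simp add: powr_mult)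
  finally have "d * (t + \<bar>x - y\<bar>) powr (1/2 + 1) \<le> d * (18 powr (1/2 + 1) * (t * sqrt t))"
    using assms(3) by (rule mult_left_mono)
  moreover have "(t + \<bar>x - y\<bar>) powr (1/2 + 1) > 0" using assms by simp
  ultimately show ?thesis using assms by (simp add: field_simps)
qed

lemma kernel_size_switched_bump: "kernel_size switched_bump (1/2) 1"
  unfolding kernel_size_def
proof (intro exI[of _ "18 powr (1/2 + 1)"] allI impI)
  fix t x y :: real assume t: "0 < t"
  show "cmod (switched_bump t x y) \<le> 18 powr (1/2 + 1) * (t powr 1 / (t + \<bar>x - y\<bar>) powr (1/2 + 1))"
  proof (cases "\<bar>x - y\<bar> < 16 * t")
    case True
    have "cmod (switched_bump t x y) \<le> 1 / sqrt t"
      using bump_bounds[OF t, of x y] True t unfolding norm_switched_bump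
      by (auto simp: indicator_def dist_real_def split: if_splits)
    also have "\<dots> = t / (t * sqrt t)" using t by simp
    also have "\<dots> \<le> 18 powr (1/2 + 1) * (t / (t + \<bar>x - y\<bar>) powr (1/2 + 1))"
      using t True by (intro kernel_tail_bound) auto
    finally show ?thesis using t by simp
  next
    case False
    then have "switched_bump t x y = 0" using t by (simp add: switched_bump_def bump_def)
    then show ?thesis by simp
  qed
qed

lemma kernel_smoothness_switched_bump: "kernel_smoothness switched_bump (1/2) 1"
  unfolding kernel_smoothness_def
proof (intro exI[of _ "18 powr (1/2 + 1)"] allI impI)
  fix t x y z :: real assume t: "0 < t" and yz: "\<bar>y - z\<bar> < t / 2"
  have eq: "cmod (switched_bump t x y - switched_bump t x z) = indicator active (x, t) * \<bar>bump t x y - bump t x z\<bar>"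
    unfolding switched_bump_def of_real_diff[symmetric] norm_of_real
    by (simp add: abs_mult flip: right_diff_distrib)
  show "cmod (switched_bump t x y - switched_bump t x z)
    \<le> 18 powr (1/2 + 1) * (\<bar>y - z\<bar> powr 1 / (t + \<bar>x - y\<bar>) powr (1/2 + 1))"
  proof (cases "\<bar>x - y\<bar> \<le> 17 * t")
    case True
    have "\<bar>max 0 (1 - \<bar>x - y\<bar> / (16 * t)) - max 0 (1 - \<bar>x - z\<bar> / (16 * t))\<bar>
        \<le> \<bar>\<bar>x - y\<bar> / (16 * t) - \<bar>x - z\<bar> / (16 * t)\<bar>"
      by linarith
    also have "\<dots> = \<bar>\<bar>x - y\<bar> - \<bar>x - z\<bar>\<bar> / (16 * t)"
      using t by (simp flip: diff_divide_distrib)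
    also have "\<dots> \<le> \<bar>y - z\<bar> / t"
      using t by (intro frac_le) auto
    finally have "\<bar>max 0 (1 - \<bar>x - y\<bar> / (16 * t)) - max 0 (1 - \<bar>x - z\<bar> / (16 * t))\<bar> \<le> \<bar>y - z\<bar> / t" .
    from divide_right_mono[OF this, of "sqrt t"]
    have "\<bar>bump t x y - bump t x z\<bar> \<le> \<bar>y - z\<bar> / t / sqrt t"
      using t unfolding bump_def diff_divide_distrib[symmetric] abs_divide by simp
    then have "cmod (switched_bump t x y - switched_bump t x z) \<le> \<bar>y - z\<bar> / (t * sqrt t)"
      unfolding eq using t by (auto simp: indicator_def)
    also have "\<dots> \<le> 18 powr (1/2 + 1) * (\<bar>y - z\<bar> / (t + \<bar>x - y\<bar>) powr (1/2 + 1))"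
      using t True by (intro kernel_tail_bound) auto
    finally show ?thesis by simp
  next
    case False
    then have "16 * t \<le> \<bar>x - y\<bar>" "16 * t \<le> \<bar>x - z\<bar>" using t yz by linarith+
    then have "switched_bump t x y = 0" "switched_bump t x z = 0" using t by (simp_all add: switched_bump_def bump_def)
    then show ?thesis by simp
  qed
qed

interpretation cantor_pair: pair_sigma_finite cantor_measure cantor_measure ..

section \<open>Boundedness for aperture one\<close>
lemma ennreal_mult3:
  "0 \<le> b \<Longrightarrow> 0 \<le> c \<Longrightarrow> ennreal a * ennreal b * ennreal c = ennreal (a * b * c)"
  by (simp add: ennreal_mult'')

text \<open>
  Cauchy--Schwarz on the support of the bump, whose mass is at most a multiple of \<open>sqrt t\<close> by the
  growth of the measure.
\<close>
lemma theta_switched_bump_le: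
  assumes t: "0 < t" and [measurable]: "f \<in> borel_measurable cantor_measure"
  shows "ennreal ((cmod (theta cantor_measure switched_bump t f y))\<^sup>2) \<le>
    indicator active (y, t) * (ennreal (20 / sqrt t) *
      (\<integral>\<^sup>+z. indicator (ball y (16 * t)) z * (ennreal (cmod (f z)))\<^sup>2 \<partial>cantor_measure))"
proof (cases "(y, t) \<in> active")
  case True
  let ?\<theta> = "theta cantor_measure switched_bump t f y" and ?B = "ball y (16 * t)"
  have [measurable]: "?B \<in> sets cantor_measure" by simp
  have "ennreal (cmod ?\<theta>) \<le> (\<integral>\<^sup>+z. ennreal (cmod (switched_bump t y z * f z)) \<partial>cantor_measure)"
    unfolding theta_def
    by (cases "integrable cantor_measure (\<lambda>z. switched_bump t y z * f z)")
      (auto simp: not_integrable_integral_eq intro!: integral_norm_bound_ennreal)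
  also have "\<dots> \<le> (\<integral>\<^sup>+z. (ennreal (1 / sqrt t) * indicator ?B z) *
      (indicator ?B z * ennreal (cmod (f z))) \<partial>cantor_measure)"
  proof (rule nn_integral_mono)
    fix z
    have "cmod (switched_bump t y z * f z) \<le> indicator ?B z / sqrt t * cmod (f z)"
      using bump_bounds[OF t, of y z] True
      unfolding norm_mult norm_switched_bump by (intro mult_right_mono) auto
    then show "ennreal (cmod (switched_bump t y z * f z))
      \<le> (ennreal (1 / sqrt t) * indicator ?B z) * (indicator ?B z * ennreal (cmod (f z)))"
      using t by (auto simp: indicator_def ennreal_mult[symmetric] split: if_splits)
  qed
  finally have "(ennreal (cmod ?\<theta>))\<^sup>2 \<le> \<dots>\<^sup>2" by (rule power_mono) simp
  also have "\<dots> \<le> (\<integral>\<^sup>+z. (ennreal (1 / sqrt t) * indicator ?B z)\<^sup>2 \<partial>cantor_measure) *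
      (\<integral>\<^sup>+z. (indicator ?B z * ennreal (cmod (f z)))\<^sup>2 \<partial>cantor_measure)"
    by (rule Cauchy_Schwarz_nn_integral) measurable
  also have "\<dots> = (ennreal (1 / t) * emeasure cantor_measure ?B) *
      (\<integral>\<^sup>+z. indicator ?B z * (ennreal (cmod (f z)))\<^sup>2 \<partial>cantor_measure)"
  proof -
    have "(ennreal (1 / sqrt t) * indicator ?B z)\<^sup>2 = ennreal (1 / t) * indicator ?B z" for z
      using t by (auto simp: indicator_def ennreal_power power_divide)
    moreover have "(indicator ?B z * ennreal (cmod (f z)))\<^sup>2 = indicator ?B z * (ennreal (cmod (f z)))\<^sup>2" for z
      by (auto simp: indicator_def)
    ultimately show ?thesis by (simp add: nn_integral_cmult_indicator)
  qed
  also have "\<dots> \<le> ennreal (20 / sqrt t) *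
      (\<integral>\<^sup>+z. indicator ?B z * (ennreal (cmod (f z)))\<^sup>2 \<partial>cantor_measure)"
  proof (rule mult_right_mono)
    have "sqrt (6 * (16 * t)) \<le> sqrt (100 * t)" using t by (intro real_sqrt_le_mono) simp
    moreover have "sqrt (100 * t) = 10 * sqrt t" by (simp add: real_sqrt_mult)
    ultimately have "2 * sqrt (6 * (16 * t)) \<le> 20 * sqrt t" by linarith
    then have "1 / t * (2 * sqrt (6 * (16 * t))) \<le> 1 / t * (20 * sqrt t)"
      using t by (intro mult_left_mono) auto
    also have "\<dots> = 20 / sqrt t" using t by (simp add: field_simps)
    finally have "ennreal (1 / t) * ennreal (2 * sqrt (6 * (16 * t))) \<le> ennreal (20 / sqrt t)"
      using t by (simp add: ennreal_mult[symmetric])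
    moreover have "ennreal (1 / t) * emeasure cantor_measure ?B
        \<le> ennreal (1 / t) * ennreal (2 * sqrt (6 * (16 * t)))"
      using t by (intro mult_left_mono cantor_measure_ball_le) simp_all
    ultimately show "ennreal (1 / t) * emeasure cantor_measure ?B \<le> ennreal (20 / sqrt t)"
      by (rule order_trans[rotated])
  qed simp
  finally show ?thesis using True by (simp add: ennreal_power)
next
  case False
  then have "switched_bump t y z = 0" for z by (simp add: switched_bump_def)
  then show ?thesis by (simp add: theta_def)
qed

text \<open>After exchanging the integrals, the inner one is the mass in \<open>stray_set_local_mass\<close>.\<close>
lemma stray_local_energy:
  assumes [measurable]: "g \<in> borel_measurable cantor_measure"
  shows "(\<integral>\<^sup>+y. indicator (stray_set k) y *
      (\<integral>\<^sup>+z. indicator (ball y (16 * cell_size k)) z * g z \<partial>cantor_measure) \<partial>cantor_measure)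
    \<le> ennreal (2 * cell_mass (Suc k)) * (\<integral>\<^sup>+z. g z \<partial>cantor_measure)"
proof -
  let ?r = "16 * cell_size k"
  have [measurable]: "Measurable.pred (cantor_measure \<Otimes>\<^sub>M cantor_measure) (\<lambda>p. \<bar>fst p - snd p\<bar> < ?r)"
    by measurable
  have [measurable]: "stray_set k \<in> sets cantor_measure" by simp
  have "(\<integral>\<^sup>+y. indicator (stray_set k) y * (\<integral>\<^sup>+z. indicator (ball y ?r) z * g z \<partial>cantor_measure) \<partial>cantor_measure)
    = (\<integral>\<^sup>+y. \<integral>\<^sup>+z. indicator (stray_set k) y * indicator {p. \<bar>fst p - snd p\<bar> < ?r} (y, z) * g z \<partial>cantor_measure \<partial>cantor_measure)"
  proof (rule nn_integral_cong)
    fix y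
    have [measurable]: "ball y ?r \<in> sets cantor_measure" by simp
    have "indicator (stray_set k) y * indicator {p. \<bar>fst p - snd p\<bar> < ?r} (y, z) * g z
      = indicator (stray_set k) y * (indicator (ball y ?r) z * g z)" for z
      by (simp add: indicator_def dist_real_def)
    then show "indicator (stray_set k) y * (\<integral>\<^sup>+z. indicator (ball y ?r) z * g z \<partial>cantor_measure) =
      (\<integral>\<^sup>+z. indicator (stray_set k) y * indicator {p. \<bar>fst p - snd p\<bar> < ?r} (y, z) * g z \<partial>cantor_measure)"
      by (simp add: nn_integral_cmult)
  qed
  also have "\<dots> = (\<integral>\<^sup>+z. \<integral>\<^sup>+y. indicator (stray_set k) y * indicator {p. \<bar>fst p - snd p\<bar> < ?r} (y, z) * g z \<partial>cantor_measure \<partial>cantor_measure)"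
    by (rule cantor_pair.Fubini'[symmetric]) measurable
  also have "\<dots> \<le> (\<integral>\<^sup>+z. ennreal (2 * cell_mass (Suc k)) * g z \<partial>cantor_measure)"
  proof (rule nn_integral_mono)
    fix z
    have "(\<integral>\<^sup>+y. indicator (stray_set k) y * indicator {p. \<bar>fst p - snd p\<bar> < ?r} (y, z) * g z \<partial>cantor_measure)
      = (\<integral>\<^sup>+y. g z * indicator (stray_set k \<inter> ball z ?r) y \<partial>cantor_measure)"
      by (intro nn_integral_cong) (simp add: indicator_def dist_real_def abs_minus_commute)
    also have "\<dots> = g z * emeasure cantor_measure (stray_set k \<inter> ball z ?r)"
      by (rule nn_integral_cmult_indicator) simp
    also have "\<dots> \<le> g z * ennreal (2 * cell_mass (Suc k))"
      by (intro mult_left_mono stray_set_local_mass) simp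
    finally show "(\<integral>\<^sup>+y. indicator (stray_set k) y * indicator {p. \<bar>fst p - snd p\<bar> < ?r} (y, z) * g z \<partial>cantor_measure)
      \<le> ennreal (2 * cell_mass (Suc k)) * g z" by (simp add: mult.commute)
  qed
  also have "\<dots> = ennreal (2 * cell_mass (Suc k)) * (\<integral>\<^sup>+z. g z \<partial>cantor_measure)"
    by (rule nn_integral_cmult) measurable
  finally show ?thesis .
qed

lemma measurable_ball_integral:
  assumes [measurable]: "g \<in> borel_measurable cantor_measure"
  shows "(\<lambda>y. \<integral>\<^sup>+z. indicator (ball y r) z * g z \<partial>cantor_measure) \<in> borel_measurable cantor_measure"
proof -
  have ball: "indicator (ball y r) z = (indicator {p. \<bar>fst p - snd p\<bar> < r} (y, z) :: ennreal)" for y z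
    by (simp add: indicator_def dist_real_def)
  have [measurable]: "Measurable.pred (cantor_measure \<Otimes>\<^sub>M cantor_measure) (\<lambda>p. \<bar>fst p - snd p\<bar> < r)"
    by measurable
  show ?thesis unfolding ball by measurable
qed

text \<open>
  A majorant for the energy density of \<open>S\<^sub>1\<close> on generation \<open>k\<close>, with \<open>g\<close> standing for \<open>|f|\<^sup>2\<close>. Its
  constant is \<open>2 M \<cdot> 20 / t\<^sup>2\<close>, with \<open>M\<close> the mass of a child and \<open>t\<close> replaced by \<open>cell_size k / 2\<close>.
\<close>
definition layer_energy :: "(real \<Rightarrow> ennreal) \<Rightarrow> nat \<Rightarrow> real \<Rightarrow> real \<Rightarrow> ennreal" where
  "layer_energy g k t y = ennreal (160 * cell_mass (Suc k) / (cell_size k)\<^sup>2) * (indicator {cell_size k / 2..cell_size k} t *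
     (indicator (stray_set k) y * (\<integral>\<^sup>+z. indicator (ball y (16 * cell_size k)) z * g z \<partial>cantor_measure)))"

text \<open>
  Generation \<open>k\<close> contributes \<open>160 M\<^sup>2 / L\<close> with \<open>M\<close> the mass of a child and \<open>L\<close> the size of the cell; since
  \<open>L\<close> is the square of the mass of the cell, this is \<open>160 / (branching k)\<^sup>2\<close>.
\<close>
lemma
  assumes g [measurable]: "g \<in> borel_measurable cantor_measure"
  shows measurable_layer_energy: "(\<lambda>y. layer_energy g k t y) \<in> borel_measurable cantor_measure"
    and measurable_layer_energy_integral:
      "(\<lambda>t. \<integral>\<^sup>+y. layer_energy g k t y \<partial>cantor_measure) \<in> borel_measurable lborel"
    and layer_energy_integral_le: "(\<integral>\<^sup>+t. \<integral>\<^sup>+y. layer_energy g k t y \<partial>cantor_measure \<partial>lborel)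
    \<le> ennreal (160 / (real (branching k))\<^sup>2) * (\<integral>\<^sup>+z. g z \<partial>cantor_measure)"
proof -
  let ?c = "160 * cell_mass (Suc k) / (cell_size k)\<^sup>2" and ?I = "{cell_size k / 2..cell_size k}"
  let ?E = "\<integral>\<^sup>+z. g z \<partial>cantor_measure"
  have c: "0 \<le> ?c" "0 \<le> cell_size k" "0 \<le> cell_mass (Suc k)"
    using cell_mass_pos[of "Suc k"] cell_size_pos[of k] by auto
  have [measurable]: "stray_set k \<in> sets cantor_measure" by simp
  note measurable_ball_integral[OF g, measurable]
  have m: "(\<lambda>y. indicator (stray_set k) y * (\<integral>\<^sup>+z. indicator (ball y (16 * cell_size k)) z * g z \<partial>cantor_measure))
      \<in> borel_measurable cantor_measure"
    by measurable
  then show "(\<lambda>y. layer_energy g k t y) \<in> borel_measurable cantor_measure"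
    unfolding layer_energy_def by measurable
  show "(\<lambda>t. \<integral>\<^sup>+y. layer_energy g k t y \<partial>cantor_measure) \<in> borel_measurable lborel"
    unfolding layer_energy_def using m by (simp add: nn_integral_cmult)
  have "(\<integral>\<^sup>+t. \<integral>\<^sup>+y. layer_energy g k t y \<partial>cantor_measure \<partial>lborel)
    \<le> (\<integral>\<^sup>+t. ennreal ?c * (ennreal (2 * cell_mass (Suc k)) * ?E) * indicator ?I t \<partial>lborel)"
  proof (rule nn_integral_mono)
    fix t
    show "(\<integral>\<^sup>+y. layer_energy g k t y \<partial>cantor_measure)
      \<le> ennreal ?c * (ennreal (2 * cell_mass (Suc k)) * ?E) * indicator ?I t"
      using mult_left_mono[OF stray_local_energy[OF g, of k], of "ennreal ?c"] m
      unfolding layer_energy_def by (auto simp: nn_integral_cmult indicator_def)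
  qed
  also have "\<dots> = ennreal ?c * (ennreal (2 * cell_mass (Suc k)) * ?E) * ennreal (cell_size k / 2)"
    using c by (subst nn_integral_cmult_indicator) (auto simp: field_simps)
  also have "\<dots> = ennreal ?c * ennreal (2 * cell_mass (Suc k)) * ennreal (cell_size k / 2) * ?E"
    by (simp only: mult_ac)
  also have "ennreal ?c * ennreal (2 * cell_mass (Suc k)) * ennreal (cell_size k / 2)
      = ennreal (?c * (2 * cell_mass (Suc k)) * (cell_size k / 2))"
    using c by (intro ennreal_mult3) auto
  also have "?c * (2 * cell_mass (Suc k)) * (cell_size k / 2) = 160 / (real (branching k))\<^sup>2"
    using branching_ge[of k] cell_mass_pos[of k]
    by (simp add: cell_size_def cell_mass_Suc power2_eq_square field_simps)
  finally show "(\<integral>\<^sup>+t. \<integral>\<^sup>+y. layer_energy g k t y \<partial>cantor_measure \<partial>lborel)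
    \<le> ennreal (160 / (real (branching k))\<^sup>2) * ?E" .
qed

text \<open>The radius is written \<open>1 * t\<close> to match the integrand of \<open>square_fun_Tonelli\<close> at \<open>\<beta> = 1\<close>.\<close>
lemma energy_density_le:
  assumes t: "0 < t" and f: "f \<in> borel_measurable cantor_measure"
  shows "emeasure cantor_measure (ball y (1 * t)) *
      ennreal ((cmod (theta cantor_measure switched_bump t f y))\<^sup>2 / t powr (1/2 + 1))
    \<le> (\<Sum>k. layer_energy (\<lambda>z. (ennreal (cmod (f z)))\<^sup>2) k t y)"
proof (cases "(y, t) \<in> active")
  case True
  then obtain k where y: "y \<in> stray_set k" and tk: "cell_size k / 2 \<le> t" "t \<le> cell_size k"
    by (auto simp: active_def)
  let ?m = "cell_mass (Suc k)" and ?\<theta> = "(cmod (theta cantor_measure switched_bump t f y))\<^sup>2"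
  let ?F = "\<lambda>r. \<integral>\<^sup>+z. indicator (ball y r) z * (ennreal (cmod (f z)))\<^sup>2 \<partial>cantor_measure"
  have m: "0 \<le> ?m" using cell_mass_pos[of "Suc k"] by simp
  have "ennreal (?\<theta> / t powr (1/2 + 1)) = ennreal (1 / (t * sqrt t)) * ennreal ?\<theta>"
    using t half_power[OF t] by (simp add: ennreal_mult[symmetric])
  also have "\<dots> \<le> ennreal (1 / (t * sqrt t)) * (ennreal (20 / sqrt t) * ?F (16 * t))"
    using theta_switched_bump_le[OF t f, of y] True by (intro mult_left_mono) auto
  also have "\<dots> \<le> ennreal (1 / (t * sqrt t)) * (ennreal (20 / sqrt t) * ?F (16 * cell_size k))"
    using tk by (intro mult_left_mono nn_integral_mono mult_right_mono) (auto simp: indicator_def)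
  finally have "emeasure cantor_measure (ball y (1 * t)) * ennreal (?\<theta> / t powr (1/2 + 1))
    \<le> ennreal (2 * ?m) * (ennreal (1 / (t * sqrt t)) * (ennreal (20 / sqrt t) * ?F (16 * cell_size k)))"
    using stray_set_isolated[OF y tk(2)] by (intro mult_mono) auto
  also have "\<dots> = ennreal (2 * ?m) * ennreal (1 / (t * sqrt t)) * ennreal (20 / sqrt t) * ?F (16 * cell_size k)"
    by (simp only: mult_ac)
  also have "ennreal (2 * ?m) * ennreal (1 / (t * sqrt t)) * ennreal (20 / sqrt t)
      = ennreal (2 * ?m * (1 / (t * sqrt t)) * (20 / sqrt t))"
    using t by (intro ennreal_mult3) auto
  also have "ennreal (2 * ?m * (1 / (t * sqrt t)) * (20 / sqrt t)) * ?F (16 * cell_size k)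
      \<le> ennreal (160 * ?m / (cell_size k)\<^sup>2) * ?F (16 * cell_size k)"
  proof (intro mult_right_mono ennreal_leI)
    have "2 * ?m * (1 / (t * sqrt t)) * (20 / sqrt t) = 40 * ?m / t\<^sup>2"
      using t by (simp add: power2_eq_square mult_ac)
    also have "\<dots> \<le> 40 * ?m / (cell_size k / 2)\<^sup>2"
      using m tk t cell_size_pos[of k] by (intro divide_left_mono power_mono) auto
    also have "\<dots> = 160 * ?m / (cell_size k)\<^sup>2" by (simp add: power_divide)
    finally show "2 * ?m * (1 / (t * sqrt t)) * (20 / sqrt t) \<le> 160 * ?m / (cell_size k)\<^sup>2" .
  qed simp
  also have "\<dots> = layer_energy (\<lambda>z. (ennreal (cmod (f z)))\<^sup>2) k t y"
    using y tk by (simp add: layer_energy_def)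
  also have "\<dots> \<le> (\<Sum>k. layer_energy (\<lambda>z. (ennreal (cmod (f z)))\<^sup>2) k t y)"
    using sum_le_suminf[OF summableI, of "{k}" "\<lambda>k. layer_energy (\<lambda>z. (ennreal (cmod (f z)))\<^sup>2) k t y"] by simp
  finally show ?thesis .
next
  case False
  then have "switched_bump t y z = 0" for z by (simp add: switched_bump_def)
  then show ?thesis by (simp add: theta_def)
qed

lemma bounded_square_fun: "bounded_on_L2 cantor_measure (square_fun cantor_measure (1/2) switched_bump 1)"
proof -
  have s: "summable (\<lambda>k. 160 / (real (branching k))\<^sup>2)"
    using summable_mult[OF summable_ignore_initial_segment[OF inverse_power_summable[of 2, where 'a=real]], of 160 100]
    by (simp add: branching_def divide_inverse)
  define C where "C = (\<Sum>k. 160 / (real (branching k))\<^sup>2)"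
  have C: "0 \<le> C" unfolding C_def by (rule suminf_nonneg[OF s]) simp
  have main: "square_fun cantor_measure (1/2) switched_bump 1 f \<in> borel_measurable cantor_measure \<and>
     L2_norm cantor_measure (square_fun cantor_measure (1/2) switched_bump 1 f)
      \<le> ennreal (sqrt C) * L2_norm cantor_measure (\<lambda>x. ennreal (cmod (f x)))"
    if f [measurable]: "f \<in> borel_measurable cantor_measure" for f
  proof
    let ?g = "\<lambda>z. (ennreal (cmod (f z)))\<^sup>2"
    have g: "?g \<in> borel_measurable cantor_measure" by measurable
    note T = square_fun_Tonelli[OF cantor.sigma_finite_measure_axioms sets_cantor_measure measurable_switched_bump f]
    show "square_fun cantor_measure (1/2) switched_bump 1 f \<in> borel_measurable cantor_measure" by (rule T)
    have "(\<integral>\<^sup>+x. (square_fun cantor_measure (1/2) switched_bump 1 f x)\<^sup>2 \<partial>cantor_measure)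
      \<le> (\<integral>\<^sup>+t. \<integral>\<^sup>+y. (\<Sum>k. layer_energy ?g k t y) \<partial>cantor_measure \<partial>lborel)"
      unfolding T(2) using energy_density_le[OF _ f]
      by (intro nn_integral_mono) (auto simp: indicator_def intro!: nn_integral_mono)
    also have "\<dots> = (\<Sum>k. \<integral>\<^sup>+t. \<integral>\<^sup>+y. layer_energy ?g k t y \<partial>cantor_measure \<partial>lborel)"
      using measurable_layer_energy[OF g] measurable_layer_energy_integral[OF g]
      by (simp add: nn_integral_suminf)
    also have "\<dots> \<le> (\<Sum>k. ennreal (160 / (real (branching k))\<^sup>2) * (\<integral>\<^sup>+z. ?g z \<partial>cantor_measure))"
      by (intro suminf_le layer_energy_integral_le[OF g] summableI)
    also have "\<dots> = ennreal C * (\<integral>\<^sup>+z. ?g z \<partial>cantor_measure)"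
      unfolding C_def using s by (simp add: ennreal_suminf_multc suminf_ennreal2)
    finally show "L2_norm cantor_measure (square_fun cantor_measure (1/2) switched_bump 1 f)
      \<le> ennreal (sqrt C) * L2_norm cantor_measure (\<lambda>x. ennreal (cmod (f x)))"
      unfolding L2_norm_def using esqrt_mult_le[OF C] by (blast intro: order_trans esqrt_mono)
  qed
  show ?thesis
    unfolding bounded_on_L2_def
  proof (intro exI[of _ "sqrt C"] allI impI)
    fix f assume f: "cmem_L2 cantor_measure f"
    then have "ennreal (sqrt C) * L2_norm cantor_measure (\<lambda>x. ennreal (cmod (f x))) < \<infinity>"
      by (simp add: cmem_L2_def ennreal_mult_less_top)
    then show "mem_L2 cantor_measure (square_fun cantor_measure (1/2) switched_bump 1 f) \<and>
      L2_norm cantor_measure (square_fun cantor_measure (1/2) switched_bump 1 f)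
      \<le> ennreal (sqrt C) * L2_norm cantor_measure (\<lambda>x. ennreal (cmod (f x)))"
      using main[of f] f unfolding mem_L2_def cmem_L2_def by (blast intro: le_less_trans)
  qed
qed

section \<open>Divergence for larger apertures\<close>

text \<open>
  The bump is at least half of \<open>1 / sqrt t\<close> on a whole cell, and the mass of the cell is
  \<open>sqrt (cell_size k) \<ge> sqrt t\<close>.
\<close>
lemma theta_one_ge:
  assumes y: "y \<in> stray_set k" and t: "cell_size k / 2 \<le> t" "t \<le> cell_size k"
  shows "1 / 2 \<le> cmod (theta cantor_measure switched_bump t (\<lambda>_. 1) y)"
proof -
  have pos: "0 < t" using t cell_size_pos[of k] by simp
  have act: "(y, t) \<in> active" using y t by (auto simp: active_def)
  let ?B = "cball y (4 * cell_size k)"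
  have mB: "cell_mass k \<le> measure cantor_measure ?B"
    using stray_set_cell_mass[OF y] by (simp add: cantor.emeasure_eq_measure)
  have sq: "sqrt t \<le> cell_mass k"
    using t(2) cell_mass_pos[of k] unfolding cell_size_def by (intro real_le_lsqrt) auto
  have int: "integrable cantor_measure (\<lambda>z. bump t y z)"
  proof (rule cantor.integrable_const_bound[of _ "1 / sqrt t"], intro AE_I2)
    fix z
    have "indicator (ball y (16 * t)) z / sqrt t \<le> 1 / sqrt t"
      using pos by (intro divide_right_mono) auto
    then show "norm (bump t y z) \<le> 1 / sqrt t"
      using bump_bounds[OF pos, of y z] by simp
  qed measurable
  have low: "indicator ?B z * (1 / (2 * sqrt t)) \<le> bump t y z" for z
  proof (cases "z \<in> ?B")
    case True
    then have "\<bar>y - z\<bar> \<le> 4 * cell_size k" by (simp add: dist_real_def)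
    then have "\<bar>y - z\<bar> / (16 * t) \<le> 1 / 2" using t pos by (simp add: field_simps)
    then have "(1/2) / sqrt t \<le> bump t y z"
      unfolding bump_def using pos by (intro divide_right_mono) auto
    then show ?thesis using True by simp
  qed (use bump_bounds(1)[OF pos, of y z] in simp)
  have "1 / 2 \<le> measure cantor_measure ?B * (1 / (2 * sqrt t))"
    using mB sq pos by (simp add: field_simps)
  also have "\<dots> = (\<integral>z. indicator ?B z * (1 / (2 * sqrt t)) \<partial>cantor_measure)"
    by simp
  also have "\<dots> \<le> (\<integral>z. bump t y z \<partial>cantor_measure)"
    by (intro integral_mono int low) (auto simp: cantor.emeasure_eq_measure)
  also have "\<dots> = cmod (theta cantor_measure switched_bump t (\<lambda>_. 1) y)"
    using act bump_bounds(1)[OF pos] unfolding theta_def switched_bump_def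
    by (simp add: integral_nonneg)
  finally show ?thesis .
qed

text \<open>
  The third condition on \<open>\<eta>\<close> and the condition on \<open>k\<close> say that \<open>\<beta> t\<close> is long enough for
  \<open>stray_set_enlarged_ball_mass\<close> when \<open>t\<close> lies in the last fraction \<open>\<eta>\<close> of the range below
  \<open>cell_size k\<close>.
\<close>
lemma layer_lower_bound:
  assumes \<eta>: "0 < \<eta>" "\<eta> \<le> 1/2" "1 + 2 * \<eta> \<le> \<beta> * (1 - \<eta>)" and k: "4 / real (branching k) \<le> \<eta>"
    and t: "(1 - \<eta>) * cell_size k \<le> t" "t \<le> cell_size k"
  shows "ennreal (\<eta> / (4 * cell_size k * real (branching k)))
    \<le> (\<integral>\<^sup>+y. emeasure cantor_measure (ball y (\<beta> * t)) *
        ennreal ((cmod (theta cantor_measure switched_bump t (\<lambda>_. 1) y))\<^sup>2 / t powr (1/2 + 1)) \<partial>cantor_measure)"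
proof -
  let ?L = "cell_size k" and ?N = "real (branching k)"
  have L: "0 < ?L" by (rule cell_size_pos)
  have "1/2 * ?L \<le> (1 - \<eta>) * ?L" using \<eta> L by (intro mult_right_mono) auto
  then have t2: "?L / 2 \<le> t" and pos: "0 < t" using t(1) L by linarith+
  have \<beta>: "0 \<le> \<beta>"
  proof (rule ccontr)
    assume "\<not> 0 \<le> \<beta>" then have "\<beta> * (1 - \<eta>) \<le> 0" using \<eta> by (intro mult_nonpos_nonneg) auto
    then show False using \<eta> by simp
  qed
  have "?L * (1 + \<eta> + 4 / ?N) \<le> ?L * (\<beta> * (1 - \<eta>))" using L \<eta> k by (intro mult_left_mono) auto
  also have "\<dots> = \<beta> * ((1 - \<eta>) * ?L)" by simp
  also have "\<dots> \<le> \<beta> * t" using t(1) \<beta> by (rule mult_left_mono)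
  finally have r: "?L * (1 + \<eta> + 4 / ?N) \<le> \<beta> * t" .
  have sq: "sqrt ?L = cell_mass k" using cell_mass_pos[of k] by (simp add: cell_size_def)
  have "ennreal (\<eta> / (4 * ?L * ?N)) = ennreal (\<eta> / (4 * ?L)) * ennreal (1 / ?N)"
    using \<eta> L branching_ge[of k] by (simp add: ennreal_mult[symmetric])
  also have "\<dots> \<le> ennreal (\<eta> / (4 * ?L)) * emeasure cantor_measure (stray_set k)"
    by (intro mult_left_mono stray_set_mass) simp
  also have "\<dots> = (\<integral>\<^sup>+y. ennreal (\<eta> / (4 * ?L)) * indicator (stray_set k) y \<partial>cantor_measure)"
    by (simp add: nn_integral_cmult_indicator)
  also have "\<dots> \<le> (\<integral>\<^sup>+y. emeasure cantor_measure (ball y (\<beta> * t)) *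
        ennreal ((cmod (theta cantor_measure switched_bump t (\<lambda>_. 1) y))\<^sup>2 / t powr (1/2 + 1)) \<partial>cantor_measure)"
  proof (rule nn_integral_mono)
    fix y
    let ?\<theta> = "cmod (theta cantor_measure switched_bump t (\<lambda>_. 1) y)"
    show "ennreal (\<eta> / (4 * ?L)) * indicator (stray_set k) y
      \<le> emeasure cantor_measure (ball y (\<beta> * t)) * ennreal (?\<theta>\<^sup>2 / t powr (1/2 + 1))"
    proof (cases "y \<in> stray_set k")
      case True
      have "(1/2)\<^sup>2 \<le> ?\<theta>\<^sup>2" using theta_one_ge[OF True t2 t(2)] by (intro power_mono) auto
      moreover have "t * sqrt t \<le> ?L * cell_mass k"
        using t(2) pos L unfolding sq[symmetric] by (intro mult_mono) auto
      ultimately have "(1/2)\<^sup>2 / (?L * cell_mass k) \<le> ?\<theta>\<^sup>2 / t powr (1/2 + 1)"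
        unfolding half_power[OF pos] using pos by (intro frac_le) auto
      then have "ennreal (\<eta> * cell_mass k) * ennreal ((1/2)\<^sup>2 / (?L * cell_mass k))
        \<le> emeasure cantor_measure (ball y (\<beta> * t)) * ennreal (?\<theta>\<^sup>2 / t powr (1/2 + 1))"
        using stray_set_enlarged_ball_mass[OF True \<eta>(1,2) r] by (intro mult_mono ennreal_leI) auto
      moreover have "ennreal (\<eta> * cell_mass k) * ennreal ((1/2)\<^sup>2 / (?L * cell_mass k)) = ennreal (\<eta> / (4 * ?L))"
        using \<eta> L cell_mass_pos[of k] by (simp add: ennreal_mult[symmetric] power2_eq_square)
      ultimately show ?thesis using True by simp
    qed simp
  qed
  finally show ?thesis .
qed

lemma not_summable_inverse_branching: "c > 0 \<Longrightarrow> (\<Sum>k. ennreal (c / real (branching (k + n)))) = \<infinity>"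
proof (rule ccontr)
  assume c: "c > 0" and "(\<Sum>k. ennreal (c / real (branching (k + n)))) \<noteq> \<infinity>"
  then have "summable (\<lambda>k. c / real (branching (k + n)))"
    by (intro summable_suminf_not_top) auto
  then have "summable (\<lambda>k. 1 / c * (c / real (branching (k + n))))" by (rule summable_mult)
  moreover have "1 / c * (c / real (branching (k + n))) = 1 / real (k + (n + 100))" for k
    using c by (simp add: branching_def add_ac)
  ultimately have "summable (\<lambda>k. 1 / real (k + (n + 100)))" by simp
  then show False
    using summable_iff_shift[of "\<lambda>k. 1 / real k" "n + 100"] not_summable_harmonic[where 'a=real]
    by (simp add: inverse_eq_divide)
qed

text \<open>
  The ranges of \<open>t\<close> belonging to different generations are disjoint, so the lower bounds add up. Each
  range has length \<open>\<eta> * cell_size k\<close>, which leaves a fixed multiple of \<open>1 / branching k\<close>.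
\<close>
lemma square_fun_one_not_L2:
  assumes "\<beta> > 1"
  shows "\<not> mem_L2 cantor_measure (square_fun cantor_measure (1/2) switched_bump \<beta> (\<lambda>_. 1))"
proof -
  \<comment> \<open>half the largest value that satisfies \<open>1 + 2 * \<eta> \<le> \<beta> * (1 - \<eta>)\<close>, hence less than \<open>1/2\<close>\<close>
  define \<eta> where "\<eta> = (\<beta> - 1) / (2 * (\<beta> + 2))"
  have "\<eta> * (\<beta> + 2) = (\<beta> - 1) / 2" using assms by (simp add: \<eta>_def field_simps)
  then have "1 + 2 * \<eta> \<le> \<beta> * (1 - \<eta>)" using assms by (simp add: algebra_simps)
  moreover have "0 < \<eta>" "\<eta> \<le> 1/2" using assms by (auto simp: \<eta>_def field_simps)
  ultimately have \<eta>: "0 < \<eta>" "\<eta> \<le> 1/2" "1 + 2 * \<eta> \<le> \<beta> * (1 - \<eta>)" by blast+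
  obtain n :: nat where n: "4 / \<eta> \<le> real n" using real_arch_simple by blast
  have k: "4 / real (branching (k + n)) \<le> \<eta>" for k
  proof -
    have "4 / \<eta> \<le> real (branching (k + n))" using n by (simp add: branching_def)
    then show ?thesis using \<eta>(1) branching_ge[of "k + n"] by (simp add: field_simps)
  qed
  let ?G = "\<lambda>t. \<integral>\<^sup>+y. emeasure cantor_measure (ball y (\<beta> * t)) *
      ennreal ((cmod (theta cantor_measure switched_bump t (\<lambda>_. 1) y))\<^sup>2 / t powr (1/2 + 1)) \<partial>cantor_measure"
  define I where "I k = {(1 - \<eta>) * cell_size (k + n)..cell_size (k + n)}" for k
  have half: "cell_size j / 2 \<le> (1 - \<eta>) * cell_size j" for j
    using mult_right_mono[of "1/2" "1 - \<eta>" "cell_size j"] \<eta> cell_size_pos[of j] by simp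
  have disj: "i = j" if i: "t \<in> I i" and j: "t \<in> I j" for t i j
  proof -
    have False if "i < j" "t \<in> I i" "t \<in> I j" for i j
    proof -
      have "cell_size (j + n) \<le> cell_size (Suc (i + n))" using that(1) by (intro cell_size_antimono) simp
      then show ?thesis
        using that(2,3) half[of "i + n"] cell_size_Suc_le[of "i + n"] cell_size_pos[of "Suc (i + n)"]
        unfolding I_def atLeastAtMost_iff by linarith
    qed
    then show ?thesis using i j by (metis linorder_neqE_nat)
  qed
  define c where "c k = ennreal (\<eta> / (4 * cell_size (k + n) * real (branching (k + n))))" for k
  have "(\<integral>\<^sup>+t. (\<Sum>k. c k * indicator (I k) t) \<partial>lborel) \<le> (\<integral>\<^sup>+t. ?G t * indicator {0<..} t \<partial>lborel)"
  proof (rule nn_integral_mono)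
    fix t
    show "(\<Sum>k. c k * indicator (I k) t) \<le> ?G t * indicator {0<..} t"
    proof (cases "\<exists>k. t \<in> I k")
      case True
      then obtain j where j: "t \<in> I j" by blast
      have "(\<Sum>k. c k * indicator (I k) t) = (\<Sum>k\<in>{j}. c k * indicator (I k) t)"
        using disj[OF j] by (intro suminf_finite) (auto simp: indicator_def)
      also have "\<dots> = c j" using j by simp
      also have "\<dots> \<le> ?G t"
        unfolding c_def using j by (intro layer_lower_bound[OF \<eta> k]) (auto simp: I_def)
      finally have "(\<Sum>k. c k * indicator (I k) t) \<le> ?G t" .
      moreover have "0 < t"
        using j half[of "j + n"] cell_size_pos[of "j + n"] unfolding I_def atLeastAtMost_iff by linarith
      ultimately show ?thesis by simp
    qed (simp add: indicator_def)
  qed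
  moreover have "(\<integral>\<^sup>+t. (\<Sum>k. c k * indicator (I k) t) \<partial>lborel) = (\<Sum>k. c k * emeasure lborel (I k))"
    by (subst nn_integral_suminf) (auto simp: I_def nn_integral_cmult_indicator)
  moreover have "c k * emeasure lborel (I k) = ennreal (\<eta>\<^sup>2 / 4 / real (branching (k + n)))" for k
  proof -
    let ?L = "cell_size (k + n)"
    have "(1 - \<eta>) * ?L \<le> ?L" using \<eta> cell_size_pos[of "k + n"] by simp
    then have "emeasure lborel (I k) = ennreal (\<eta> * ?L)" by (simp add: I_def algebra_simps)
    then show ?thesis
      using \<eta>(1) cell_size_pos[of "k + n"] by (simp add: c_def ennreal_mult[symmetric] power2_eq_square)
  qed
  moreover have "(\<Sum>k. ennreal (\<eta>\<^sup>2 / 4 / real (branching (k + n)))) = \<infinity>"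
    using \<eta> by (intro not_summable_inverse_branching) simp
  ultimately have "(\<integral>\<^sup>+t. ?G t * indicator {0<..} t \<partial>lborel) = \<infinity>" by (simp add: top_unique)
  then have "L2_norm cantor_measure (square_fun cantor_measure (1/2) switched_bump \<beta> (\<lambda>_. 1)) = \<infinity>"
    unfolding L2_norm_def
    by (subst square_fun_Tonelli(2)[OF cantor.sigma_finite_measure_axioms sets_cantor_measure measurable_switched_bump])
      (simp_all add: esqrt_def)
  then show ?thesis by (simp add: mem_L2_def)
qed

section \<open>The counterexample\<close>

theorem theorem1p6:
  shows "\<exists>(\<mu> :: real measure) (s :: real \<Rightarrow> real \<Rightarrow> real \<Rightarrow> complex) (m :: real) (\<alpha> :: real).
     prob_space \<mu> \<and> sets \<mu> = sets borel \<and> measurable_kernels s \<and>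
     0 < m \<and> m < 1 \<and> 0 < \<alpha> \<and>
     growth_condition \<mu> m \<and> kernel_size s m \<alpha> \<and> kernel_smoothness s m \<alpha> \<and>
     bounded_on_L2 \<mu> (square_fun \<mu> m s 1) \<and>
     (\<forall>\<beta>>1. \<not> mem_L2 \<mu> (square_fun \<mu> m s \<beta> (\<lambda>_. 1)))"
proof (intro exI conjI allI impI)
  show "prob_space cantor_measure" by (rule prob_space_cantor_measure)
  show "sets cantor_measure = sets borel" by (rule sets_cantor_measure)
  show "measurable_kernels switched_bump" by (rule measurable_kernels_switched_bump)
  show "0 < (1/2 :: real)" "(1/2 :: real) < 1" "0 < (1 :: real)" by simp_all
  show "growth_condition cantor_measure (1/2)" by (rule growth_cantor_measure)
  show "kernel_size switched_bump (1/2) 1" by (rule kernel_size_switched_bump)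
  show "kernel_smoothness switched_bump (1/2) 1" by (rule kernel_smoothness_switched_bump)
  show "bounded_on_L2 cantor_measure (square_fun cantor_measure (1/2) switched_bump 1)"
    by (rule bounded_square_fun)
  show "\<not> mem_L2 cantor_measure (square_fun cantor_measure (1/2) switched_bump \<beta> (\<lambda>_. 1))"
    if "\<beta> > 1" for \<beta> :: real
    using that by (rule square_fun_one_not_L2)
qed

end
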